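(* The dyadic version of the Muckenhoupt--Wheeden conjecture is false: there exist a weight $w$ on $\mathbb{R}$ and a Haar multiplier $T$ for which there is no finite constant $C$ such that $$\sup_{t>0}\, t\, w\left(\{x\in\mathbb{R} : |Tf(x)|>t\}\right)\le C\int_{\mathbb{R}}|f(x)|\,Mw(x)\,dx\quad\text{for all } f\in L^2(\mathbb{R}).$$
   Context: A weight is a non-negative locally integrable function on $\mathbb{R}$, and $w(E)=\int_E w(x)\,dx$. $\mathcal{D}=\{[2^{k}m,2^{k}(m+1)) : m,k\in\mathbb{Z}\}$ is the usual dyadic grid. $M$ is the dyadic maximal function: for $f\in L^1_{loc}$, $f\ge 0$, $Mf(x)=\sup_{Q\in\mathcal{D}} \frac{1_Q(x)}{|Q|}\int_Q f$. For $I=[a,b)\in\mathcal{D}$ put $I^-=[a,\frac{a+b}{2})$, $I^+=[\frac{a+b}{2},b)$, and $h_I=\frac{1_{I^+}-1_{I^-}}{|I|^{1/2}}$. Given a bounded sequence $\epsilon=(\epsilon_I)_{I\in\mathcal{D}}$ of scalars, the Haar multiplier $T_\epsilon$ is $T_\epsilon f=\sum_{I\in\mathcal{D}}\epsilon_I\langle f,h_I\rangle h_I$, where $\langle\cdot,\cdot\rangle$ is the pairing with respect to Lebesgue measure (the series converges in $L^2(\mathbb{R})$ for $f\in L^2(\mathbb{R})$). *)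

theory Defs
  imports "HOL-Analysis.Analysis"
begin

definition weight :: "(real \<Rightarrow> real) \<Rightarrow> bool" where
  "weight w \<longleftrightarrow> (\<forall>x. 0 \<le> w x) \<and> (\<forall>K. compact K \<longrightarrow> set_integrable lebesgue K w)"

definition weight_measure :: "(real \<Rightarrow> real) \<Rightarrow> real set \<Rightarrow> ennreal" where
  "weight_measure w E = (\<integral>\<^sup>+x\<in>E. ennreal (w x) \<partial>lebesgue)"

definition dyadic_grid :: "real set set" where
  "dyadic_grid =
    {{2 powi k * real_of_int m ..< 2 powi k * (real_of_int m + 1)} | k m :: int. True}"

text \<open>Only used for \<open>f \<ge> 0\<close>. The value may be infinite.\<close>

definition dyadic_maximal :: "(real \<Rightarrow> real) \<Rightarrow> real \<Rightarrow> ennreal" where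
  "dyadic_maximal f x =
    (SUP Q\<in>dyadic_grid.
      indicator Q x / emeasure lebesgue Q * (\<integral>\<^sup>+y\<in>Q. ennreal (f y) \<partial>lebesgue))"

text \<open>An interval \<open>I = [a, b)\<close> is passed as a set; its end points are \<open>Inf I\<close> and \<open>Sup I\<close>.\<close>

definition left_half :: "real set \<Rightarrow> real set" where
  "left_half I = {Inf I ..< (Inf I + Sup I) / 2}"

definition right_half :: "real set \<Rightarrow> real set" where
  "right_half I = {(Inf I + Sup I) / 2 ..< Sup I}"

definition haar :: "real set \<Rightarrow> real \<Rightarrow> real" where
  "haar I x = (indicator (right_half I) x - indicator (left_half I) x) / sqrt (measure lebesgue I)"

lemma halves_atLeastLessThan:
  assumes "a < b"
  shows "left_half {a..<b} = {a ..< (a + b) / 2}" "right_half {a..<b} = {(a + b) / 2 ..< b}"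
  using assms by (simp_all add: left_half_def right_half_def)

definition L2 :: "(real \<Rightarrow> real) set" where
  "L2 = {f \<in> borel_measurable lebesgue. integrable lebesgue (\<lambda>x. (f x)\<^sup>2)}"

definition haar_coeff :: "(real \<Rightarrow> real) \<Rightarrow> real set \<Rightarrow> real" where
  "haar_coeff f I = (\<integral>x. f x * haar I x \<partial>lebesgue)"

text \<open>
  Unconditional convergence of the Haar multiplier series to \<open>g\<close> in the \<open>L2\<close> norm: the net of
  partial sums over finite sets of dyadic intervals converges to \<open>g\<close>.
\<close>

definition haar_multiplier_has_sum ::
    "(real set \<Rightarrow> real) \<Rightarrow> (real \<Rightarrow> real) \<Rightarrow> (real \<Rightarrow> real) \<Rightarrow> bool" where
  "haar_multiplier_has_sum \<epsilon> f g \<longleftrightarrow> g \<in> L2 \<and>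
    ((\<lambda>F. \<integral>\<^sup>+x. ennreal ((g x - (\<Sum>I\<in>F. \<epsilon> I * haar_coeff f I * haar I x))\<^sup>2) \<partial>lebesgue)
      \<longlongrightarrow> 0) (finite_subsets_at_top dyadic_grid)"

text \<open>
  For bounded \<open>\<epsilon>\<close> and \<open>f \<in> L2\<close> the sum exists and is unique up to a null set; the choice
  operator picks a representative. The value is unspecified if there is no sum.
\<close>

definition haar_multiplier :: "(real set \<Rightarrow> real) \<Rightarrow> (real \<Rightarrow> real) \<Rightarrow> real \<Rightarrow> real" where
  "haar_multiplier \<epsilon> f = (SOME g. haar_multiplier_has_sum \<epsilon> f g)"

end

theory Submission imports Defs begin

text \<open>
  The counterexample is a St Petersburg game. Truncated at height \<open>4\<^sup>K\<close>, a payoff of order \<open>4\<^sup>j\<close>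
  with probability of order \<open>1 / 4\<^sup>j\<close> (\<open>j < K\<close>) has a bounded weak norm, but its mean is of order \<open>K\<close>,
  and by the law of large numbers a sum of \<open>n\<close> independent copies is of order \<open>n * K\<close> with large
  probability once \<open>n\<close> is of order \<open>4\<^sup>K\<close>. A single copy is compatible with a weak type bound; a
  contradiction arises if many copies are independent while their costs only add up.

  One stage of the game lives on an interval \<open>I = [a, a + L)\<close> on which the averages of a weight \<open>w\<close>
  and a source \<open>f\<close> are given. Its spine consists of the intervals \<open>[a, a + L / 4\<^sup>j)\<close> for \<open>j < K\<close>, and its
  children are their right halves. The weight is moved to the children, with equal density on
  all of them. The source keeps its average on the children, and the rest of its mass, a fixed proportion,
  is put into the tiny gap \<open>[a, a + L / 4\<^sup>K)\<close>. As the \<open>j\<close>-th spine interval contains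
  this mass in its left half, the Haar terms of the spine add up to a value of order \<open>4\<^sup>j\<close>
  on child \<open>j \<ge> 1\<close> (\<open>neg_haar_sum_on_child\<close>, \<open>payoff_eq\<close>), which has a proportion of order
  \<open>1 / 4\<^sup>j\<close> of the weight. The children are then the intervals of the next stage. Because the payoffs of
  different stages are independent with respect to \<open>w\<close>, the Laplace transform of their sum is
  a power (\<open>exponential_moment\<close>), and the law of large numbers is the Chernoff bound
  \<open>cascade_large_deviation\<close>.

  The cost \<open>\<integral> f * M w\<close> of a stage is bounded independently of \<open>K\<close> (\<open>cascade_cost\<close>): seen from the gap, no
  dyadic interval has a larger average of \<open>w\<close> than a child, and this exceeds the average on \<open>I\<close>
  only by a factor two. So \<open>n\<close> stages cost at most \<open>n + 1\<close>, whereas the weak norm of the Haar sum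
  is at least of order \<open>n * K\<close>.

  Finally, cascades with \<open>K = k + 2\<close> are placed on the intervals \<open>[k, k + 1)\<close>. All of them have mass
  one, so averages over larger intervals do not increase the maximal function, and the
  multiplier that is \<open>- 1\<close> on all spines and \<open>0\<close> elsewhere acts on the source of one block
  through a finite sum over the spine of this block (\<open>glued_multiplier_block\<close>).
\<close>

section \<open>The cascade\<close>

text \<open>
  Half the length of the \<open>j\<close>-th spine interval \<open>[a, a + L / 4\<^sup>j)\<close> of an interval of length \<open>L\<close>; this is
  also the length of the \<open>j\<close>-th child \<open>[a + half_len j L, a + 2 * half_len j L)\<close>, its right half.
\<close>

definition half_len :: "nat \<Rightarrow> real \<Rightarrow> real" where
  "half_len j L = L / 2 * (1 / 4) ^ j"

text \<open>
  The proportion of an interval that is covered by its children. Concentrating a weight on the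
  children divides its density by this number, which lies in \<open>[1/2, 2/3)\<close> if \<open>K > 0\<close>.
\<close>

definition child_share :: "nat \<Rightarrow> real" where
  "child_share K = (\<Sum>j<K. half_len j 1)"

text \<open>
  For \<open>K > 0\<close> both functions have average one on \<open>[a, a + L)\<close>. The weight is passed on to the
  children entirely. The source keeps its average on each child, and the mass left over sits in the
  gap \<open>[a, a + L / 4\<^sup>K)\<close>, which no child meets.
\<close>

fun cascade_weight :: "nat \<Rightarrow> nat \<Rightarrow> real \<Rightarrow> real \<Rightarrow> real \<Rightarrow> real" where
  "cascade_weight K 0 a L x = indicator {a..<a + L} x"
| "cascade_weight K (Suc n) a L x =
     (\<Sum>j<K. cascade_weight K n (a + half_len j L) (half_len j L) x) / child_share K"

fun cascade_source :: "nat \<Rightarrow> nat \<Rightarrow> real \<Rightarrow> real \<Rightarrow> real \<Rightarrow> real" where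
  "cascade_source K 0 a L x = indicator {a..<a + L} x"
| "cascade_source K (Suc n) a L x =
     (\<Sum>j<K. cascade_source K n (a + half_len j L) (half_len j L) x) +
     4 ^ K * (1 - child_share K) * indicator {a..<a + 2 * half_len K L} x"

fun spine :: "nat \<Rightarrow> nat \<Rightarrow> real \<Rightarrow> real \<Rightarrow> real set set" where
  "spine K 0 a L = {}"
| "spine K (Suc n) a L =
     (\<lambda>j. {a..<a + 2 * half_len j L}) ` {..<K} \<union>
     (\<Union>j<K. spine K n (a + half_len j L) (half_len j L))"

lemma half_len_pos: "0 < L \<Longrightarrow> 0 < half_len j L"
  by (simp add: half_len_def)

lemma half_len_scale: "half_len j L = L * half_len j 1"
  by (simp add: half_len_def)

lemma two_half_len_le: "0 < L \<Longrightarrow> 2 * half_len j L \<le> L"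
  by (simp add: half_len_def power_le_one)

lemma half_len_decay:
  assumes "i < j" "0 < L"
  shows "4 * half_len j L \<le> half_len i L"
proof -
  have "(1 / 4 :: real) ^ j \<le> (1 / 4) ^ Suc i"
    using assms by (intro power_decreasing) auto
  then have "L / 2 * (1 / 4) ^ j \<le> L / 2 * (1 / 4) ^ Suc i"
    using assms by (intro mult_left_mono) auto
  then show ?thesis
    by (simp add: half_len_def)
qed

lemma sum_half_len: "(\<Sum>i<j. half_len i L) = L * (2 / 3) * (1 - (1 / 4) ^ j)"
proof (induction j)
  case (Suc j)
  show ?case
    by (simp only: sum.lessThan_Suc Suc.IH) (simp add: half_len_def algebra_simps)
qed simp

lemma child_share_eq: "child_share K = (2 / 3) * (1 - (1 / 4) ^ K)"
  using sum_half_len[of 1 K] by (simp add: child_share_def)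

lemma child_share_less_1: "child_share K < 1"
proof -
  have "0 < (1 / 4 :: real) ^ K"
    by (rule zero_less_power) simp
  then show ?thesis
    unfolding child_share_eq by argo
qed

lemma child_share_ge_half:
  assumes "0 < K" shows "1 / 2 \<le> child_share K"
proof -
  have "(1 / 4 :: real) ^ K \<le> (1 / 4) ^ 1"
    using assms by (intro power_decreasing) auto
  then show ?thesis
    by (simp add: child_share_eq)
qed

lemma child_subset:
  assumes "0 < L"
  shows "{a + half_len j L..<a + half_len j L + half_len j L} \<subseteq> {a..<a + L}"
  using two_half_len_le[OF assms, of j] half_len_pos[OF assms, of j] by auto

lemma children_disjoint:
  assumes "0 < L" "i \<noteq> j"
    "x \<in> {a + half_len i L..<a + half_len i L + half_len i L}"
  shows "x \<notin> {a + half_len j L..<a + half_len j L + half_len j L}"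
  using assms half_len_decay[of i j L] half_len_decay[of j i L]
    half_len_pos[OF assms(1), of i] half_len_pos[OF assms(1), of j]
  by (cases i j rule: linorder_cases) auto

lemma gap_disjoint_child:
  assumes "0 < L" "j < K" "x \<in> {a..<a + 2 * half_len K L}"
  shows "x \<notin> {a + half_len j L..<a + half_len j L + half_len j L}"
  using assms half_len_decay[of j K L] half_len_pos[OF assms(1), of K] by auto

lemma cascade_weight_nonneg: "0 \<le> cascade_weight K n a L x"
  by (induction n arbitrary: a L)
    (auto intro!: divide_nonneg_nonneg sum_nonneg simp: child_share_def half_len_def)

lemma cascade_source_nonneg: "0 \<le> cascade_source K n a L x"
  using child_share_less_1[of K]
  by (induction n arbitrary: a L) (auto intro!: add_nonneg_nonneg sum_nonneg mult_nonneg_nonneg)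

lemma cascade_weight_eq_0:
  "0 < L \<Longrightarrow> x \<notin> {a..<a + L} \<Longrightarrow> cascade_weight K n a L x = 0"
proof (induction n arbitrary: a L)
  case (Suc n)
  have "cascade_weight K n (a + half_len j L) (half_len j L) x = 0" for j
    using Suc child_subset[of L a j] by (intro Suc.IH half_len_pos) auto
  then show ?case by simp
qed simp

lemma cascade_source_eq_0:
  "0 < L \<Longrightarrow> x \<notin> {a..<a + L} \<Longrightarrow> cascade_source K n a L x = 0"
proof (induction n arbitrary: a L)
  case (Suc n)
  have "cascade_source K n (a + half_len j L) (half_len j L) x = 0" for j
    using Suc child_subset[of L a j] by (intro Suc.IH half_len_pos) auto
  moreover have "x \<notin> {a..<a + 2 * half_len K L}"
    using Suc.prems two_half_len_le[of L K] by auto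
  ultimately show ?case by simp
qed simp

lemma sum_only_child:
  fixes g :: "nat \<Rightarrow> real"
  assumes "j < K" "\<And>i. i \<noteq> j \<Longrightarrow> g i = 0"
  shows "(\<Sum>i<K. g i) = g j"
  using assms by (subst sum.remove[of _ j]) (auto intro!: sum.neutral)

lemma cascade_weight_on_child:
  assumes "0 < L" "j < K" "x \<in> {a + half_len j L..<a + half_len j L + half_len j L}"
  shows "cascade_weight K (Suc n) a L x =
    cascade_weight K n (a + half_len j L) (half_len j L) x / child_share K"
proof -
  have "cascade_weight K n (a + half_len i L) (half_len i L) x = 0" if "i \<noteq> j" for i
    using assms that children_disjoint[of L j i x a]
    by (intro cascade_weight_eq_0 half_len_pos) auto
  then show ?thesis
    using sum_only_child[OF assms(2)] by simp
qed

lemma cascade_source_on_child: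
  assumes "0 < L" "j < K" "x \<in> {a + half_len j L..<a + half_len j L + half_len j L}"
  shows "cascade_source K (Suc n) a L x =
    cascade_source K n (a + half_len j L) (half_len j L) x"
proof -
  have "cascade_source K n (a + half_len i L) (half_len i L) x = 0" if "i \<noteq> j" for i
    using assms that children_disjoint[of L j i x a]
    by (intro cascade_source_eq_0 half_len_pos) auto
  moreover have "x \<notin> {a..<a + 2 * half_len K L}"
    using assms gap_disjoint_child by blast
  ultimately show ?thesis
    using sum_only_child[OF assms(2), of "\<lambda>i. cascade_source K n (a + half_len i L) (half_len i L) x"]
    by simp
qed

lemma has_integral_indicator_interval:
  fixes c d :: real
  assumes "c \<le> d"
  shows "has_bochner_integral lebesgue (indicator {c..<d} :: real \<Rightarrow> real) (d - c)"
  using assms has_bochner_integral_real_indicator[of "{c..<d}" lebesgue] by simp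

lemma cascade_weight_integral:
  assumes "0 < K" "0 < L"
  shows "has_bochner_integral lebesgue (cascade_weight K n a L) L"
  using assms(2)
proof (induction n arbitrary: a L)
  case 0
  then show ?case
    using has_integral_indicator_interval[of a "a + L"] by simp
next
  case (Suc n)
  have "has_bochner_integral lebesgue (cascade_weight K (Suc n) a L)
      ((\<Sum>j<K. half_len j L) / child_share K)"
    unfolding cascade_weight.simps
    using Suc by (intro has_bochner_integral_divide_zero has_bochner_integral_sum Suc.IH half_len_pos)
  moreover have "(\<Sum>j<K. half_len j L) = L * child_share K"
    by (simp add: child_share_eq sum_half_len)
  ultimately show ?case
    using child_share_ge_half[OF assms(1)] by (simp del: cascade_weight.simps)
qed

lemma gap_mass:
  "4 ^ K * (1 - child_share K) * (2 * half_len K L) = L * (1 - child_share K)"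
  by (simp add: half_len_def power_one_over)

lemma cascade_source_integral:
  assumes "0 < L"
  shows "has_bochner_integral lebesgue (cascade_source K n a L) L"
  using assms
proof (induction n arbitrary: a L)
  case 0
  then show ?case
    using has_integral_indicator_interval[of a "a + L"] by simp
next
  case (Suc n)
  have "has_bochner_integral lebesgue (indicator {a..<a + 2 * half_len K L} :: real \<Rightarrow> real)
      (2 * half_len K L)"
    using has_integral_indicator_interval[of a "a + 2 * half_len K L"] half_len_pos[OF Suc.prems, of K]
    by simp
  then have "has_bochner_integral lebesgue (cascade_source K (Suc n) a L)
      ((\<Sum>j<K. half_len j L) + 4 ^ K * (1 - child_share K) * (2 * half_len K L))"
    unfolding cascade_source.simps
    using Suc by (intro has_bochner_integral_add has_bochner_integral_mult_right
        has_bochner_integral_sum Suc.IH half_len_pos)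
  moreover have "(\<Sum>j<K. half_len j L) = L * child_share K"
    by (simp add: child_share_eq sum_half_len)
  ultimately show ?case
    by (simp only: gap_mass) (simp add: right_diff_distrib del: cascade_source.simps)
qed

lemma spine_member:
  assumes "0 < L" "I \<in> spine K n a L"
  shows "\<exists>c d. I = {c..<d} \<and> c < d \<and> a \<le> c \<and> d \<le> a + L"
  using assms
proof (induction n arbitrary: a L)
  case (Suc n)
  consider j where "I = {a..<a + 2 * half_len j L}"
    | j where "I \<in> spine K n (a + half_len j L) (half_len j L)"
    using Suc.prems by auto
  then show ?case
  proof cases
    case 1
    have "a < a + 2 * half_len j L" "a + 2 * half_len j L \<le> a + L"
      using Suc.prems two_half_len_le[of L j] half_len_pos[of L j] by auto
    with 1 show ?thesis
      by blast
  next
    case 2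
    from Suc.IH[OF half_len_pos[OF Suc.prems(1)] this]
    obtain c d where "I = {c..<d}" "c < d" "a + half_len j L \<le> c"
      "d \<le> a + half_len j L + half_len j L"
      by blast
    moreover from this have "a \<le> c" "d \<le> a + L"
      using two_half_len_le[OF Suc.prems(1), of j] half_len_pos[OF Suc.prems(1), of j] by auto
    ultimately show ?thesis
      by blast
  qed
qed simp

lemma finite_spine: "finite (spine K n a L)"
  by (induction n arbitrary: a L) auto

section \<open>Haar coefficients of the source along the spine\<close>

text \<open>
  The sign makes the term of an interval non-negative on its right half if the left half holds at
  least as much mass of \<open>f\<close> as the right half, which is the situation on the spine.
\<close>

definition neg_haar_sum :: "real set set \<Rightarrow> (real \<Rightarrow> real) \<Rightarrow> real \<Rightarrow> real" where
  "neg_haar_sum A f x = - (\<Sum>I\<in>A. haar_coeff f I * haar I x)"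

text \<open>
  Half the difference between the averages of the source over the left and right halves of the
  \<open>j\<close>-th spine interval.
\<close>

definition spine_gain :: "nat \<Rightarrow> real" where
  "spine_gain j = (4 ^ j - 1) / 3"

text \<open>
  The contribution of one stage on the \<open>j\<close>-th child: this child is the right half of the \<open>j\<close>-th spine
  interval, lies in the left halves of the earlier ones and is disjoint from the later ones.
\<close>

definition payoff :: "nat \<Rightarrow> real" where
  "payoff j = spine_gain j - (\<Sum>i<j. spine_gain i)"

lemma payoff_eq: "payoff j = 2 * (4 ^ j - 1) / 9 + real j / 3"
proof -
  have "(\<Sum>i<j. spine_gain i) = ((4 ^ j - 1) / 3 - real j) / 3"
    by (induction j) (simp_all add: spine_gain_def field_simps)
  then show ?thesis
    by (simp add: payoff_def spine_gain_def field_simps)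
qed

lemma haar_interval:
  assumes "0 < l"
  shows "haar {a..<a + 2 * l} x =
    (indicator {a + l..<a + l + l} x - indicator {a..<a + l} x) / sqrt (2 * l)"
proof -
  have "a < a + 2 * l"
    using assms by simp
  moreover have "(a + (a + 2 * l)) / 2 = a + l" "a + 2 * l = a + l + l"
    by simp_all
  moreover have "measure lebesgue {a..<a + 2 * l} = 2 * l"
    using assms by simp
  ultimately show ?thesis
    by (metis haar_def halves_atLeastLessThan)
qed

lemma haar_eq_0:
  assumes "c < d" "x \<notin> {c..<d}"
  shows "haar {c..<d} x = 0"
  using assms by (auto simp: haar_def halves_atLeastLessThan indicator_def)

text \<open>
  All the mass outside the children \<open>0, \<dots>, j\<close> lies in the left half of the \<open>j\<close>-th spine interval.
  This half therefore holds at least a third of the mass \<open>L\<close>, however large \<open>j\<close> is.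
\<close>

lemma cascade_source_left_mass:
  assumes "0 < L" "j < K"
  shows "has_bochner_integral lebesgue
    (\<lambda>x. cascade_source K (Suc n) a L x * indicator {a..<a + half_len j L} x)
    (L - (\<Sum>i<Suc j. half_len i L))"
proof -
  have child: "has_bochner_integral lebesgue
      (\<lambda>x. cascade_source K n (a + half_len i L) (half_len i L) x * indicator {a..<a + half_len j L} x)
      (if j < i then half_len i L else 0)" for i
  proof (cases "j < i")
    case True
    have "cascade_source K n (a + half_len i L) (half_len i L) x * indicator {a..<a + half_len j L} x =
      cascade_source K n (a + half_len i L) (half_len i L) x" for x
    proof (cases "x \<in> {a + half_len i L..<a + half_len i L + half_len i L}")
      case True
      then have "x \<in> {a..<a + half_len j L}"
        using half_len_decay[OF \<open>j < i\<close> assms(1)] half_len_pos[OF assms(1), of i] by auto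
      then show ?thesis by simp
    next
      case False
      then show ?thesis
        using cascade_source_eq_0[OF half_len_pos[OF assms(1)]] by simp
    qed
    then have "(\<lambda>x. cascade_source K n (a + half_len i L) (half_len i L) x * indicator {a..<a + half_len j L} x) =
      cascade_source K n (a + half_len i L) (half_len i L)"
      by blast
    then show ?thesis
      using True cascade_source_integral[OF half_len_pos[OF assms(1)]] by presburger
  next
    case False
    have le: "half_len j L \<le> half_len i L"
    proof (cases "i = j")
      case False
      then show ?thesis
        using \<open>\<not> j < i\<close> half_len_decay[of i j L] assms half_len_pos[OF assms(1), of j] by simp
    qed simp
    have "cascade_source K n (a + half_len i L) (half_len i L) x * indicator {a..<a + half_len j L} x = 0" for x
      using le cascade_source_eq_0[OF half_len_pos[OF assms(1), of i], of x "a + half_len i L"]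
      by (auto simp: indicator_def)
    then have "(\<lambda>x. cascade_source K n (a + half_len i L) (half_len i L) x * indicator {a..<a + half_len j L} x) =
      (\<lambda>_. 0)"
      by blast
    then show ?thesis
      using False by (simp only: if_False has_bochner_integral_zero)
  qed
  have gap: "has_bochner_integral lebesgue
      (\<lambda>x. indicator {a..<a + 2 * half_len K L} x * indicator {a..<a + half_len j L} x :: real)
      (2 * half_len K L)"
  proof -
    have "(\<lambda>x. indicator {a..<a + 2 * half_len K L} x * indicator {a..<a + half_len j L} x :: real) =
      indicator {a..<a + 2 * half_len K L}"
      using half_len_decay[OF assms(2,1)] half_len_pos[OF assms(1), of K]
      by (auto simp: indicator_def fun_eq_iff)
    then show ?thesis
      using has_integral_indicator_interval[of a "a + 2 * half_len K L"] half_len_pos[OF assms(1), of K]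
      by simp
  qed
  have "has_bochner_integral lebesgue
      (\<lambda>x. (\<Sum>i<K. cascade_source K n (a + half_len i L) (half_len i L) x * indicator {a..<a + half_len j L} x) +
        4 ^ K * (1 - child_share K) *
          (indicator {a..<a + 2 * half_len K L} x * indicator {a..<a + half_len j L} x))
      ((\<Sum>i<K. if j < i then half_len i L else 0) + 4 ^ K * (1 - child_share K) * (2 * half_len K L))"
    by (intro has_bochner_integral_add has_bochner_integral_mult_right has_bochner_integral_sum child gap)
  moreover have "(\<Sum>i<K. if j < i then half_len i L else 0) =
      L * child_share K - (\<Sum>i<Suc j. half_len i L)"
  proof -
    have "(\<Sum>i<Suc j. half_len i L) = (\<Sum>i<K. if i < Suc j then half_len i L else 0)"
      using assms by (intro sum.mono_neutral_cong_left) auto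
    then have "(\<Sum>i<K. if j < i then half_len i L else 0) + (\<Sum>i<Suc j. half_len i L) =
      (\<Sum>i<K. half_len i L)"
      by (simp only: sum.distrib[symmetric]) (intro sum.cong, auto)
    moreover have "(\<Sum>i<K. half_len i L) = L * child_share K"
      by (simp add: child_share_eq sum_half_len)
    ultimately show ?thesis
      by linarith
  qed
  ultimately show ?thesis
    by (simp only: gap_mass cascade_source.simps) (simp add: algebra_simps sum_distrib_left sum_distrib_right)
qed

lemma cascade_source_right_mass:
  assumes "0 < L" "j < K"
  shows "has_bochner_integral lebesgue
    (\<lambda>x. cascade_source K (Suc n) a L x * indicator {a + half_len j L..<a + half_len j L + half_len j L} x)
    (half_len j L)"
proof -
  have "(\<lambda>x. cascade_source K (Suc n) a L x * indicator {a + half_len j L..<a + half_len j L + half_len j L} x) =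
    cascade_source K n (a + half_len j L) (half_len j L)"
    (is "?f = ?g")
  proof
    fix x
    show "?f x = ?g x"
    proof (cases "x \<in> {a + half_len j L..<a + half_len j L + half_len j L}")
      case True
      then show ?thesis
        using cascade_source_on_child[OF assms True, of n] by (simp del: cascade_source.simps)
    next
      case False
      then show ?thesis
        using cascade_source_eq_0[OF half_len_pos[OF assms(1)] False, of K n]
        by (simp del: cascade_source.simps)
    qed
  qed
  then show ?thesis
    using cascade_source_integral[OF half_len_pos[OF assms(1)]] by metis
qed

lemma spine_term:
  assumes "0 < L" "j < K"
  shows "haar_coeff (cascade_source K (Suc n) a L) {a..<a + 2 * half_len j L} *
      haar {a..<a + 2 * half_len j L} x =
    spine_gain j * (indicator {a..<a + half_len j L} x -
      indicator {a + half_len j L..<a + half_len j L + half_len j L} x)"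
proof -
  let ?l = "half_len j L"
  have l: "0 < ?l"
    using half_len_pos[OF assms(1)] .
  have "has_bochner_integral lebesgue
      (\<lambda>x. (cascade_source K (Suc n) a L x * indicator {a + ?l..<a + ?l + ?l} x -
         cascade_source K (Suc n) a L x * indicator {a..<a + ?l} x) / sqrt (2 * ?l))
      ((?l - (L - (\<Sum>i<Suc j. half_len i L))) / sqrt (2 * ?l))"
    by (intro has_bochner_integral_divide_zero has_bochner_integral_diff
        cascade_source_left_mass cascade_source_right_mass assms)
  then have "haar_coeff (cascade_source K (Suc n) a L) {a..<a + 2 * ?l} =
      (?l - (L - (\<Sum>i<Suc j. half_len i L))) / sqrt (2 * ?l)"
    unfolding haar_coeff_def haar_interval[OF l]
    by (intro has_bochner_integral_integral_eq)
      (simp add: right_diff_distrib del: cascade_source.simps)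
  then have "haar_coeff (cascade_source K (Suc n) a L) {a..<a + 2 * ?l} * haar {a..<a + 2 * ?l} x =
      (?l - (L - (\<Sum>i<Suc j. half_len i L))) / (2 * ?l) *
        (indicator {a + ?l..<a + ?l + ?l} x - indicator {a..<a + ?l} x)"
    using l by (simp only: haar_interval[OF l]) simp
  also have "(?l - (L - (\<Sum>i<Suc j. half_len i L))) / (2 * ?l) = - spine_gain j"
    unfolding sum_half_len using assms(1)
    by (simp add: half_len_def spine_gain_def field_simps)
  also have "- spine_gain j * (indicator {a + ?l..<a + ?l + ?l} x - indicator {a..<a + ?l} x) =
      spine_gain j * (indicator {a..<a + ?l} x - indicator {a + ?l..<a + ?l + ?l} x)"
    by (simp add: algebra_simps)
  finally show ?thesis .
qed

text \<open>
  This is the renewal structure of the cascade. On a child the source is again a cascade source,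
  and the Haar functions of the intervals inside the child see nothing else of it.
\<close>

lemma neg_haar_sum_on_child:
  assumes "0 < L" "j < K" and x: "x \<in> {a + half_len j L..<a + half_len j L + half_len j L}"
  shows "neg_haar_sum (spine K (Suc n) a L) (cascade_source K (Suc n) a L) x =
    payoff j + neg_haar_sum (spine K n (a + half_len j L) (half_len j L))
      (cascade_source K n (a + half_len j L) (half_len j L)) x"
proof -
  let ?f = "cascade_source K (Suc n) a L"
  let ?g = "\<lambda>I. haar_coeff ?f I * haar I x"
  let ?top = "\<lambda>i. {a..<a + 2 * half_len i L}"
  let ?sub = "\<lambda>i. spine K n (a + half_len i L) (half_len i L)"
  have sub_in: "I \<subseteq> {a + half_len i L..<a + half_len i L + half_len i L}" "I \<noteq> {}" if "I \<in> ?sub i" for I i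
    using spine_member[OF half_len_pos[OF assms(1)] that] by auto
  have inj: "inj_on ?top {..<K}"
  proof (rule inj_onI)
    fix i i' assume "?top i = ?top i'"
    then have "half_len i L = half_len i' L"
      using half_len_pos[OF assms(1), of i] half_len_pos[OF assms(1), of i']
        atLeastLessThan_inj(2)[of a "a + 2 * half_len i L" a "a + 2 * half_len i' L"] by simp
    then show "i = i'"
      using half_len_decay[of i i' L] half_len_decay[of i' i L] assms(1) half_len_pos[OF assms(1), of i]
      by (cases i i' rule: linorder_cases) auto
  qed
  have disj_top: "?top ` {..<K} \<inter> (\<Union>i<K. ?sub i) = {}"
  proof -
    have "a \<in> ?top i" for i
      using half_len_pos[OF assms(1), of i] by simp
    moreover have "a \<notin> I" if "I \<in> ?sub i" for I i
      using sub_in(1)[OF that] half_len_pos[OF assms(1), of i] by auto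
    ultimately show ?thesis
      by blast
  qed
  have disj_sub: "?sub i \<inter> ?sub i' = {}" if "i \<noteq> i'" for i i'
  proof (rule ccontr)
    assume "?sub i \<inter> ?sub i' \<noteq> {}"
    then obtain I where I: "I \<in> ?sub i" "I \<in> ?sub i'"
      by blast
    then obtain y where "y \<in> I"
      using sub_in(2) by blast
    then show False
      using children_disjoint[OF assms(1) that, of y a] sub_in(1)[OF I(1)] sub_in(1)[OF I(2)] by blast
  qed
  have "sum ?g (spine K (Suc n) a L) = sum ?g (?top ` {..<K}) + sum ?g (\<Union>i<K. ?sub i)"
    unfolding spine.simps by (intro sum.union_disjoint disj_top) (auto simp: finite_spine)
  also have "sum ?g (?top ` {..<K}) = - payoff j"
  proof -
    have "sum ?g (?top ` {..<K}) = (\<Sum>i<K. spine_gain i * (indicator {a..<a + half_len i L} x -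
        indicator {a + half_len i L..<a + half_len i L + half_len i L} x))"
      unfolding sum.reindex[OF inj] o_def using assms(1)
      by (intro sum.cong spine_term refl) auto
    also have "\<dots> = (\<Sum>i<K. if i < Suc j then (if i = j then - spine_gain j else spine_gain i) else 0)"
    proof (rule sum.cong)
      fix i assume "i \<in> {..<K}"
      consider "i < j" | "i = j" | "j < i" by linarith
      then show "spine_gain i * (indicator {a..<a + half_len i L} x -
          indicator {a + half_len i L..<a + half_len i L + half_len i L} x) =
        (if i < Suc j then (if i = j then - spine_gain j else spine_gain i) else 0)"
        using x half_len_decay[OF _ assms(1), of i j] half_len_decay[OF _ assms(1), of j i]
          half_len_pos[OF assms(1), of i] half_len_pos[OF assms(1), of j]
        by cases auto
    qed simp
    also have "\<dots> = (\<Sum>i<Suc j. if i = j then - spine_gain j else spine_gain i)"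
      using assms(2) by (intro sum.mono_neutral_cong_right) auto
    also have "\<dots> = - payoff j"
      by (simp add: payoff_def)
    finally show ?thesis .
  qed
  also have "sum ?g (\<Union>i<K. ?sub i) = (\<Sum>i<K. sum ?g (?sub i))"
    using disj_sub by (intro sum.UNION_disjoint) (auto simp: finite_spine)
  also have "\<dots> = sum ?g (?sub j)"
  proof (rule sum_only_child[OF assms(2)])
    fix i assume "i \<noteq> j"
    show "sum ?g (?sub i) = 0"
    proof (intro sum.neutral ballI)
      fix I assume I: "I \<in> ?sub i"
      then have "x \<notin> I"
        using sub_in(1)[OF I] children_disjoint[OF assms(1) \<open>i \<noteq> j\<close>[symmetric] x] by blast
      then have "haar I x = 0"
        using spine_member[OF half_len_pos[OF assms(1)] I] haar_eq_0 by metis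
      then show "?g I = 0" by simp
    qed
  qed
  also have "\<dots> = (\<Sum>I\<in>?sub j. haar_coeff (cascade_source K n (a + half_len j L) (half_len j L)) I * haar I x)"
  proof (intro sum.cong refl)
    fix I assume I: "I \<in> ?sub j"
    have "?f y * haar I y = cascade_source K n (a + half_len j L) (half_len j L) y * haar I y" for y
    proof (cases "y \<in> I")
      case True
      then have "y \<in> {a + half_len j L..<a + half_len j L + half_len j L}"
        using sub_in(1)[OF I] by blast
      from cascade_source_on_child[OF assms(1,2) this, of n] show ?thesis
        by (simp del: cascade_source.simps)
    next
      case False
      then have "haar I y = 0"
        using spine_member[OF half_len_pos[OF assms(1)] I] haar_eq_0 by metis
      then show ?thesis by simp
    qed
    then have "haar_coeff ?f I = haar_coeff (cascade_source K n (a + half_len j L) (half_len j L)) I"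
      unfolding haar_coeff_def by presburger
    then show "?g I = haar_coeff (cascade_source K n (a + half_len j L) (half_len j L)) I * haar I x"
      by (simp del: cascade_source.simps)
  qed
  finally show ?thesis
    by (simp add: neg_haar_sum_def del: spine.simps cascade_source.simps)
qed

section \<open>Exponential moments of the Haar sum\<close>

text \<open>
  The expectation of \<open>exp (- \<theta> * payoff j)\<close> when child \<open>j\<close> is drawn with probability proportional
  to its length.
\<close>

definition stage_moment :: "nat \<Rightarrow> real \<Rightarrow> real" where
  "stage_moment K \<theta> = (\<Sum>j<K. half_len j 1 * exp (- \<theta> * payoff j)) / child_share K"

text \<open>
  Under the probability measure with density \<open>cascade_weight K n a L / L\<close> the payoffs of the \<open>n\<close>
  stages are independent and identically distributed, so the moment factorises.
\<close>

lemma exponential_moment: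
  assumes "0 < L"
  shows "has_bochner_integral lebesgue
    (\<lambda>x. exp (- \<theta> * neg_haar_sum (spine K n a L) (cascade_source K n a L) x) * cascade_weight K n a L x)
    (L * stage_moment K \<theta> ^ n)"
  using assms
proof (induction n arbitrary: a L)
  case 0
  then show ?case
    using has_integral_indicator_interval[of a "a + L"] by (simp add: neg_haar_sum_def)
next
  case (Suc n)
  let ?E = "\<lambda>n a L x. exp (- \<theta> * neg_haar_sum (spine K n a L) (cascade_source K n a L) x) *
    cascade_weight K n a L x"
  let ?child = "\<lambda>j. ?E n (a + half_len j L) (half_len j L)"
  have eq: "?E (Suc n) a L x = (\<Sum>j<K. exp (- \<theta> * payoff j) * ?child j x) / child_share K" for x
  proof (cases "\<exists>j<K. x \<in> {a + half_len j L..<a + half_len j L + half_len j L}")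
    case True
    then obtain j where j: "j < K" "x \<in> {a + half_len j L..<a + half_len j L + half_len j L}"
      by blast
    have "?child i x = 0" if "i \<noteq> j" for i
      using cascade_weight_eq_0[OF half_len_pos[OF Suc.prems]]
        children_disjoint[OF Suc.prems that[symmetric] j(2)] by simp
    then have "(\<Sum>j<K. exp (- \<theta> * payoff j) * ?child j x) = exp (- \<theta> * payoff j) * ?child j x"
      by (intro sum_only_child j(1)) simp
    then show ?thesis
      unfolding neg_haar_sum_on_child[OF Suc.prems j] cascade_weight_on_child[OF Suc.prems j]
      by (simp add: exp_add[symmetric] algebra_simps)
  next
    case False
    then have "cascade_weight K n (a + half_len i L) (half_len i L) x = 0" if "i < K" for i
      using that cascade_weight_eq_0[OF half_len_pos[OF Suc.prems]] by blast
    then show ?thesis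
      by (simp del: spine.simps cascade_source.simps)
  qed
  have "has_bochner_integral lebesgue
      (\<lambda>x. (\<Sum>j<K. exp (- \<theta> * payoff j) * ?child j x) / child_share K)
      ((\<Sum>j<K. exp (- \<theta> * payoff j) * (half_len j L * stage_moment K \<theta> ^ n)) / child_share K)"
    using Suc by (intro has_bochner_integral_divide_zero has_bochner_integral_sum
        has_bochner_integral_mult_right Suc.IH half_len_pos)
  moreover have "(\<Sum>j<K. exp (- \<theta> * payoff j) * (half_len j L * stage_moment K \<theta> ^ n)) / child_share K =
      L * stage_moment K \<theta> ^ Suc n"
  proof -
    have "(\<Sum>j<K. exp (- \<theta> * payoff j) * (half_len j L * stage_moment K \<theta> ^ n)) =
        L * stage_moment K \<theta> ^ n * (\<Sum>j<K. half_len j 1 * exp (- \<theta> * payoff j))"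
      unfolding half_len_scale[of _ L] by (simp add: sum_distrib_left mult_ac)
    then show ?thesis
      by (simp add: stage_moment_def)
  qed
  ultimately show ?case
    unfolding eq by metis
qed

section \<open>The dyadic grid and its maximal function\<close>

lemma dyadic_interval:
  assumes "Q \<in> dyadic_grid"
  obtains c l where "Q = {c..<c + l}" "0 < l"
proof -
  obtain k m where "Q = {2 powi k * real_of_int m ..< 2 powi k * (real_of_int m + 1)}"
    using assms unfolding dyadic_grid_def by blast
  then have "Q = {2 powi k * real_of_int m ..< 2 powi k * real_of_int m + 2 powi k}"
    by (simp add: distrib_left)
  then show ?thesis
    using that by simp
qed

lemma dyadic_grid_halves:
  assumes "{a..<a + L} \<in> dyadic_grid" "0 < L"
  shows "{a..<a + L / 2} \<in> dyadic_grid" "{a + L / 2..<a + L} \<in> dyadic_grid"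
proof -
  obtain k m where "{a..<a + L} = {2 powi k * real_of_int m ..< 2 powi k * (real_of_int m + 1)}"
    using assms unfolding dyadic_grid_def by blast
  moreover have "2 powi k * real_of_int m < 2 powi k * (real_of_int m + 1)"
    by simp
  ultimately have "a = 2 powi k * real_of_int m" "a + L = 2 powi k * (real_of_int m + 1)"
    using assms(2) atLeastLessThan_inj[of a "a + L"] by auto
  then have a: "a = 2 powi k * real_of_int m" and L: "L = 2 powi k"
    by (simp_all add: distrib_left)
  have half: "2 powi k = (2 :: real) * 2 powi (k - 1)"
    by (simp add: power_int_diff)
  have "{a..<a + L / 2} = {2 powi (k - 1) * real_of_int (2 * m) ..< 2 powi (k - 1) * (real_of_int (2 * m) + 1)}"
    unfolding a L half by (simp add: algebra_simps)
  then show "{a..<a + L / 2} \<in> dyadic_grid"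
    unfolding dyadic_grid_def by blast
  have "{a + L / 2..<a + L} =
      {2 powi (k - 1) * real_of_int (2 * m + 1) ..< 2 powi (k - 1) * (real_of_int (2 * m + 1) + 1)}"
    unfolding a L half by (simp add: algebra_simps)
  then show "{a + L / 2..<a + L} \<in> dyadic_grid"
    unfolding dyadic_grid_def by blast
qed

lemma spine_top_dyadic:
  assumes "{a..<a + L} \<in> dyadic_grid" "0 < L"
  shows "{a..<a + 2 * half_len j L} \<in> dyadic_grid"
proof (induction j)
  case 0
  then show ?case
    using assms by (simp add: half_len_def)
next
  case (Suc j)
  have "{a..<a + half_len j L} \<in> dyadic_grid"
    using dyadic_grid_halves(1)[OF Suc] half_len_pos[OF assms(2), of j] by simp
  from dyadic_grid_halves(1)[OF this half_len_pos[OF assms(2)]] show ?case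
    by (simp add: half_len_def)
qed

lemma child_dyadic:
  assumes "{a..<a + L} \<in> dyadic_grid" "0 < L"
  shows "{a + half_len j L..<a + half_len j L + half_len j L} \<in> dyadic_grid"
proof -
  have "a + 2 * half_len j L / 2 = a + half_len j L" "a + 2 * half_len j L = a + half_len j L + half_len j L"
    by simp_all
  moreover have "0 < 2 * half_len j L"
    using half_len_pos[OF assms(2), of j] by simp
  ultimately show ?thesis
    using dyadic_grid_halves(2)[OF spine_top_dyadic[OF assms, of j]] by metis
qed

lemma spine_dyadic:
  assumes "{a..<a + L} \<in> dyadic_grid" "0 < L"
  shows "spine K n a L \<subseteq> dyadic_grid"
  using assms
proof (induction n arbitrary: a L)
  case (Suc n)
  have "spine K n (a + half_len j L) (half_len j L) \<subseteq> dyadic_grid" for j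
    using Suc by (intro Suc.IH child_dyadic half_len_pos)
  then show ?case
    using spine_top_dyadic[OF Suc.prems] by auto
qed simp

lemma dyadic_grid_nested_aux:
  fixes k k' m m' :: int
  assumes "k \<le> k'"
    and x: "x \<in> {2 powi k * real_of_int m ..< 2 powi k * (real_of_int m + 1)}"
      "x \<in> {2 powi k' * real_of_int m' ..< 2 powi k' * (real_of_int m' + 1)}"
  shows "{2 powi k * real_of_int m ..< 2 powi k * (real_of_int m + 1)} \<subseteq>
    {2 powi k' * real_of_int m' ..< 2 powi k' * (real_of_int m' + 1)}"
proof -
  define s :: real where "s = 2 powi k"
  define N :: int where "N = 2 ^ nat (k' - k)"
  have s: "0 < s"
    by (simp add: s_def)
  have k': "2 powi k' = s * real_of_int N"
  proof -
    have "2 powi (k + (k' - k)) = s * 2 powi (k' - k)"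
      unfolding s_def by (subst power_int_add) simp_all
    then show ?thesis
      using assms(1) by (simp add: N_def power_int_def)
  qed
  have "s * real_of_int m < s * (real_of_int N * (real_of_int m' + 1))"
    "s * (real_of_int N * real_of_int m') < s * (real_of_int m + 1)"
    using x unfolding k' s_def[symmetric] by (auto simp: mult.assoc)
  then have "real_of_int m < real_of_int (N * (m' + 1))" "real_of_int (N * m') < real_of_int (m + 1)"
    using s by auto
  then have "m + 1 \<le> N * (m' + 1)" "N * m' \<le> m"
    by linarith+
  then have "real_of_int (m + 1) \<le> real_of_int (N * (m' + 1))" "real_of_int (N * m') \<le> real_of_int m"
    by linarith+
  then have "s * real_of_int (m + 1) \<le> s * real_of_int (N * (m' + 1))"
    "s * real_of_int (N * m') \<le> s * real_of_int m"
    using s by (auto intro: mult_left_mono)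
  then show ?thesis
    unfolding k' s_def[symmetric] by (auto simp: mult.assoc)
qed

lemma dyadic_grid_nested:
  assumes "P \<in> dyadic_grid" "Q \<in> dyadic_grid" "P \<inter> Q \<noteq> {}"
  shows "P \<subseteq> Q \<or> Q \<subseteq> P"
proof -
  obtain k m where P: "P = {2 powi k * real_of_int m ..< 2 powi k * (real_of_int m + 1)}"
    using assms unfolding dyadic_grid_def by blast
  obtain k' m' where Q: "Q = {2 powi k' * real_of_int m' ..< 2 powi k' * (real_of_int m' + 1)}"
    using assms unfolding dyadic_grid_def by blast
  obtain x where x: "x \<in> P" "x \<in> Q"
    using assms by blast
  show ?thesis
    using dyadic_grid_nested_aux[of k k' x m m'] dyadic_grid_nested_aux[of k' k x m' m] x
    unfolding P Q by (metis linorder_le_cases)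
qed

lemma countable_dyadic_grid: "countable dyadic_grid"
proof -
  have "dyadic_grid =
    (\<lambda>(k, m). {2 powi k * real_of_int m ..< 2 powi k * (real_of_int m + 1)}) ` (UNIV :: (int \<times> int) set)"
    by (auto simp: dyadic_grid_def)
  then show ?thesis
    by (rule ssubst) (rule countable_image, rule countableI_type)
qed

lemma dyadic_maximal_measurable: "dyadic_maximal w \<in> borel_measurable lebesgue"
proof -
  have [measurable]: "Q \<in> sets lebesgue" if "Q \<in> dyadic_grid" for Q
    using that by (auto simp: dyadic_grid_def)
  have "(\<lambda>x. SUP Q\<in>dyadic_grid.
      indicator Q x / emeasure lebesgue Q * (\<integral>\<^sup>+y\<in>Q. ennreal (w y) \<partial>lebesgue)) \<in> borel_measurable lebesgue"
    by (intro borel_measurable_SUP countable_dyadic_grid) measurable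
  then show ?thesis
    by (simp add: dyadic_maximal_def[abs_def])
qed

lemma dyadic_maximal_le:
  assumes "\<And>Q. Q \<in> dyadic_grid \<Longrightarrow> x \<in> Q \<Longrightarrow>
    (\<integral>\<^sup>+y\<in>Q. ennreal (w y) \<partial>lebesgue) \<le> ennreal m * emeasure lebesgue Q"
  shows "dyadic_maximal w x \<le> ennreal m"
  unfolding dyadic_maximal_def
proof (rule SUP_least)
  fix Q assume Q: "Q \<in> dyadic_grid"
  show "indicator Q x / emeasure lebesgue Q * (\<integral>\<^sup>+y\<in>Q. ennreal (w y) \<partial>lebesgue) \<le> ennreal m"
  proof (cases "x \<in> Q")
    case True
    obtain c l where "Q = {c..<c + l}" "0 < l"
      using dyadic_interval[OF Q] .
    then have "0 < emeasure lebesgue Q"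
      by simp
    then have "(\<integral>\<^sup>+y\<in>Q. ennreal (w y) \<partial>lebesgue) / emeasure lebesgue Q \<le> ennreal m"
      using assms[OF Q True] by (intro divide_le_posI_ennreal) (simp_all add: mult.commute)
    then show ?thesis
      using True by (metis ennreal_times_divide indicator_simps(1) mult.commute mult.right_neutral)
  qed simp
qed

section \<open>The cost of the cascade\<close>

lemma cascade_weight_measurable [measurable]: "cascade_weight K n a L \<in> borel_measurable borel"
proof (induction n arbitrary: a L)
  case 0
  then show ?case
    by (simp add: cascade_weight.simps(1)[abs_def])
next
  case (Suc n)
  then show ?case
    unfolding cascade_weight.simps(2)[abs_def]
    by (intro borel_measurable_divide borel_measurable_sum) simp_all
qed

lemma cascade_source_measurable [measurable]: "cascade_source K n a L \<in> borel_measurable borel"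
proof (induction n arbitrary: a L)
  case 0
  then show ?case
    by (simp add: cascade_source.simps(1)[abs_def])
next
  case (Suc n)
  then show ?case
    unfolding cascade_source.simps(2)[abs_def]
    by (intro borel_measurable_add borel_measurable_times borel_measurable_sum) simp_all
qed

lemma borel_measurable_lebesgue: "f \<in> borel_measurable borel \<Longrightarrow> f \<in> borel_measurable lebesgue"
  by (simp add: measurable_completion)

lemma cascade_weight_nn_integral:
  assumes "0 < K" "0 < L"
  shows "(\<integral>\<^sup>+x. ennreal (cascade_weight K n a L x) \<partial>lebesgue) = ennreal L"
  using cascade_weight_integral[OF assms, of n a] cascade_weight_nonneg
  by (subst nn_integral_eq_integral) (auto simp: has_bochner_integral_iff)

text \<open>
  The weight that the set sees is spread over whole children, and over each of them it has the
  average \<open>m / child_share K\<close>.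
\<close>

lemma stage_average:
  assumes "0 < K" "0 < L" "0 \<le> m" "Q \<in> sets lebesgue" "Q \<subseteq> {a..<a + L}"
    and w: "\<And>x. x \<in> {a..<a + L} \<Longrightarrow> w x = m * cascade_weight K (Suc n) a L x"
    and children: "\<And>i. i < K \<Longrightarrow>
      {a + half_len i L..<a + half_len i L + half_len i L} \<inter> Q = {} \<or>
      {a + half_len i L..<a + half_len i L + half_len i L} \<subseteq> Q"
  shows "(\<integral>\<^sup>+y\<in>Q. ennreal (w y) \<partial>lebesgue) \<le> ennreal (m / child_share K) * emeasure lebesgue Q"
proof -
  let ?R = "\<lambda>i. {a + half_len i L..<a + half_len i L + half_len i L}"
  let ?W = "\<lambda>i. cascade_weight K n (a + half_len i L) (half_len i L)"
  have [measurable]: "?W i \<in> borel_measurable lebesgue" for i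
    by (intro borel_measurable_lebesgue cascade_weight_measurable)
  note [measurable] = assms(4)
  have nonneg: "0 \<le> m / child_share K"
    using assms(3) child_share_ge_half[OF assms(1)] by simp
  have "(\<integral>\<^sup>+y\<in>Q. ennreal (w y) \<partial>lebesgue) =
      (\<integral>\<^sup>+y. ennreal (m / child_share K) * (\<Sum>i<K. ennreal (?W i y) * indicator Q y) \<partial>lebesgue)"
  proof (intro nn_integral_cong)
    fix y
    have "ennreal (w y) = ennreal (m / child_share K) * (\<Sum>i<K. ennreal (?W i y))" if "y \<in> Q"
    proof -
      have "w y = m / child_share K * (\<Sum>i<K. ?W i y)"
        using w[of y] that assms(5) by auto
      then show ?thesis
        using nonneg cascade_weight_nonneg by (simp only: ennreal_mult' sum_ennreal)
    qed
    then show "ennreal (w y) * indicator Q y =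
        ennreal (m / child_share K) * (\<Sum>i<K. ennreal (?W i y) * indicator Q y)"
      by (cases "y \<in> Q") auto
  qed
  also have "\<dots> = ennreal (m / child_share K) * (\<Sum>i<K. \<integral>\<^sup>+y. ennreal (?W i y) * indicator Q y \<partial>lebesgue)"
    by (subst nn_integral_cmult; measurable)
      (rule arg_cong[OF nn_integral_sum], measurable)
  also have "\<dots> \<le> ennreal (m / child_share K) * (\<Sum>i<K. \<integral>\<^sup>+y. indicator (?R i) y * indicator Q y \<partial>lebesgue)"
  proof (intro mult_left_mono sum_mono)
    fix i assume "i \<in> {..<K}"
    then consider "?R i \<inter> Q = {}" | "?R i \<subseteq> Q"
      using children by blast
    then show "(\<integral>\<^sup>+y. ennreal (?W i y) * indicator Q y \<partial>lebesgue) \<le>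
        (\<integral>\<^sup>+y. indicator (?R i) y * indicator Q y \<partial>lebesgue)"
    proof cases
      case 1
      then have "?W i y = 0" if "y \<in> Q" for y
        using that by (intro cascade_weight_eq_0 half_len_pos[OF assms(2)]) blast
      then have zero: "ennreal (?W i y) * indicator Q y = 0" for y
        by (cases "y \<in> Q") simp_all
      have "(\<integral>\<^sup>+y. ennreal (?W i y) * indicator Q y \<partial>lebesgue) = (\<integral>\<^sup>+(y::real). 0 \<partial>lebesgue)"
        by (intro nn_integral_cong zero)
      then show ?thesis by simp
    next
      case 2
      have "(\<integral>\<^sup>+y. ennreal (?W i y) * indicator Q y \<partial>lebesgue) \<le> (\<integral>\<^sup>+y. ennreal (?W i y) \<partial>lebesgue)"
        by (intro nn_integral_mono) (simp add: indicator_def)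
      also have "\<dots> = ennreal (half_len i L)"
        by (intro cascade_weight_nn_integral assms half_len_pos)
      also have "\<dots> = (\<integral>\<^sup>+y. indicator (?R i) y \<partial>lebesgue)"
        using half_len_pos[OF assms(2), of i] by simp
      also have "\<dots> = (\<integral>\<^sup>+y. indicator (?R i) y * indicator Q y \<partial>lebesgue)"
        using 2 by (intro nn_integral_cong) (auto simp: indicator_def)
      finally show ?thesis .
    qed
  qed simp
  also have "(\<Sum>i<K. \<integral>\<^sup>+y. indicator (?R i) y * indicator Q y \<partial>lebesgue) =
      (\<integral>\<^sup>+y. (\<Sum>i<K. indicator (?R i) y * indicator Q y) \<partial>lebesgue)"
    using assms(4)
    by (intro nn_integral_sum[symmetric] borel_measurable_times_ennreal borel_measurable_indicator) simp_all
  also have "\<dots> \<le> (\<integral>\<^sup>+y. indicator Q y \<partial>lebesgue)"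
  proof (intro nn_integral_mono)
    fix y
    show "(\<Sum>i<K. indicator (?R i) y * indicator Q y) \<le> (indicator Q y :: ennreal)"
    proof (cases "\<exists>j<K. y \<in> ?R j")
      case True
      then obtain j where "j < K" and y: "y \<in> ?R j" by blast
      have "indicator (?R i) y = (if i = j then 1 else 0 :: ennreal)" for i
        using y children_disjoint[OF assms(2) _ y, of i] by (cases "i = j") simp_all
      then have "(\<Sum>i<K. indicator (?R i) y * indicator Q y) =
          (\<Sum>i<K. if i = j then indicator Q y else 0 :: ennreal)"
        by (intro sum.cong) simp_all
      then show ?thesis
        by (simp add: \<open>j < K\<close>)
    next
      case False
      then have "(\<Sum>i<K. indicator (?R i) y * indicator Q y) = (0 :: ennreal)"
        by (intro sum.neutral) auto
      then show ?thesis by (simp only: zero_le)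
    qed
  qed
  also have "\<dots> = emeasure lebesgue Q"
    by simp
  finally show ?thesis
    by (simp add: mult_left_mono)
qed

text \<open>
  Each stage costs at most \<open>m * L\<close>. A dyadic interval that meets the gap splits no child, so the maximal
  function there is at most the density \<open>m / child_share K\<close> of the next stage, and the gap carries source
  mass \<open>L * (1 - child_share K) \<le> L * child_share K\<close>. On the children the density is multiplied by
  \<open>1 / child_share K\<close> and the total length by \<open>child_share K\<close>, so that the costs of the later stages
  add up to the same bound. The hypothesis on larger dyadic intervals is what keeps the maximal
  function from seeing more than the local picture.
\<close>

lemma cascade_cost:
  assumes "0 < K" "0 < L" "{a..<a + L} \<in> dyadic_grid" "0 \<le> m"
    and "\<And>x. x \<in> {a..<a + L} \<Longrightarrow> w x = m * cascade_weight K n a L x"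
    and "\<And>Q. Q \<in> dyadic_grid \<Longrightarrow> {a..<a + L} \<subseteq> Q \<Longrightarrow>
      (\<integral>\<^sup>+y\<in>Q. ennreal (w y) \<partial>lebesgue) \<le> ennreal m * emeasure lebesgue Q"
  shows "(\<integral>\<^sup>+x. ennreal (cascade_source K n a L x) * dyadic_maximal w x \<partial>lebesgue) \<le>
    ennreal (real (n + 1) * m * L)"
  using assms(2-)
proof (induction n arbitrary: a L m)
  case 0
  have "dyadic_maximal w x \<le> ennreal m" if x: "x \<in> {a..<a + L}" for x
  proof (rule dyadic_maximal_le)
    fix Q assume Q: "Q \<in> dyadic_grid" "x \<in> Q"
    then consider "{a..<a + L} \<subseteq> Q" | "Q \<subseteq> {a..<a + L}"
      using dyadic_grid_nested[OF _ "0.prems"(2)] x by blast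
    then show "(\<integral>\<^sup>+y\<in>Q. ennreal (w y) \<partial>lebesgue) \<le> ennreal m * emeasure lebesgue Q"
    proof cases
      case 1
      then show ?thesis
        using Q "0.prems"(5) by blast
    next
      case 2
      then have "(\<integral>\<^sup>+y\<in>Q. ennreal (w y) \<partial>lebesgue) = (\<integral>\<^sup>+y. ennreal m * indicator Q y \<partial>lebesgue)"
        using "0.prems"(4) by (intro nn_integral_cong) (auto simp: indicator_def)
      also have "\<dots> = ennreal m * emeasure lebesgue Q"
        using Q(1) by (intro nn_integral_cmult_indicator) (auto simp: dyadic_grid_def)
      finally show ?thesis by simp
    qed
  qed
  then have "(\<integral>\<^sup>+x. ennreal (cascade_source K 0 a L x) * dyadic_maximal w x \<partial>lebesgue) \<le>
      (\<integral>\<^sup>+x. ennreal m * indicator {a..<a + L} x \<partial>lebesgue)"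
    by (intro nn_integral_mono) (auto simp: indicator_def)
  also have "\<dots> = ennreal (m * L)"
    using "0.prems" by (simp add: nn_integral_cmult_indicator ennreal_mult)
  finally show ?case by simp
next
  case (Suc n)
  note L = Suc.prems(1) and I = Suc.prems(2) and m = Suc.prems(3)
  let ?R = "\<lambda>i. {a + half_len i L..<a + half_len i L + half_len i L}"
  let ?F = "\<lambda>i. cascade_source K n (a + half_len i L) (half_len i L)"
  let ?G = "{a..<a + 2 * half_len K L}"
  let ?m = "m / child_share K"
  have \<kappa>: "1 / 2 \<le> child_share K" "child_share K < 1"
    using child_share_ge_half[OF assms(1)] child_share_less_1 by auto
  have m': "0 \<le> ?m" "m \<le> ?m"
    using m \<kappa> by (simp_all add: field_simps mult_left_le)
  have above: "(\<integral>\<^sup>+y\<in>Q. ennreal (w y) \<partial>lebesgue) \<le> ennreal ?m * emeasure lebesgue Q"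
    if "Q \<in> dyadic_grid" "{a..<a + L} \<subseteq> Q" for Q
  proof -
    have "(\<integral>\<^sup>+y\<in>Q. ennreal (w y) \<partial>lebesgue) \<le> ennreal m * emeasure lebesgue Q"
      using that Suc.prems(5) by blast
    also have "\<dots> \<le> ennreal ?m * emeasure lebesgue Q"
      using m' by (intro mult_right_mono ennreal_leI) auto
    finally show ?thesis .
  qed
  \<comment> \<open>The common case distinction for gap and children: a dyadic interval that meets the parent and is
    properly inside no child either contains the parent or splits no child.\<close>
  have average: "(\<integral>\<^sup>+y\<in>Q. ennreal (w y) \<partial>lebesgue) \<le> ennreal ?m * emeasure lebesgue Q"
    if Q: "Q \<in> dyadic_grid" "{a..<a + L} \<inter> Q \<noteq> {}" and not_inside: "\<And>i. i < K \<Longrightarrow> \<not> Q \<subset> ?R i" for Q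
  proof (cases "{a..<a + L} \<subseteq> Q")
    case True
    then show ?thesis
      using above Q by blast
  next
    case False
    then have sub: "Q \<subseteq> {a..<a + L}"
      using dyadic_grid_nested[OF I Q] by blast
    show ?thesis
    proof (rule stage_average[OF assms(1) L m _ sub Suc.prems(4)])
      show "Q \<in> sets lebesgue"
        using Q(1) by (auto simp: dyadic_grid_def)
      fix i assume "i < K"
      then show "?R i \<inter> Q = {} \<or> ?R i \<subseteq> Q"
        using dyadic_grid_nested[OF child_dyadic[OF I L] Q(1), of i] not_inside[of i] by blast
    qed
  qed
  have child: "(\<integral>\<^sup>+x. ennreal (?F i x) * dyadic_maximal w x \<partial>lebesgue) \<le>
      ennreal (real (n + 1) * ?m * half_len i L)" if i: "i < K" for i
  proof (rule Suc.IH[OF half_len_pos[OF L] child_dyadic[OF I L] m'(1)])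
    fix x assume x: "x \<in> ?R i"
    then have "w x = m * cascade_weight K (Suc n) a L x"
      using child_subset[OF L, of a i] Suc.prems(4) by blast
    then show "w x = ?m * cascade_weight K n (a + half_len i L) (half_len i L) x"
      unfolding cascade_weight_on_child[OF L i x] by simp
  next
    fix Q assume Q: "Q \<in> dyadic_grid" "?R i \<subseteq> Q"
    have x: "a + half_len i L \<in> ?R i"
      using half_len_pos[OF L, of i] by simp
    show "(\<integral>\<^sup>+y\<in>Q. ennreal (w y) \<partial>lebesgue) \<le> ennreal ?m * emeasure lebesgue Q"
    proof (rule average[OF Q(1)])
      show "{a..<a + L} \<inter> Q \<noteq> {}"
        using x Q(2) child_subset[OF L, of a i] by blast
      show "\<not> Q \<subset> ?R i'" for i'
        using x Q(2) children_disjoint[OF L _ x, of i'] by blast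
    qed
  qed
  have gap: "dyadic_maximal w x \<le> ennreal ?m" if x: "x \<in> ?G" for x
  proof (rule dyadic_maximal_le)
    fix Q assume Q: "Q \<in> dyadic_grid" "x \<in> Q"
    have "x \<in> {a..<a + L}"
      using x two_half_len_le[OF L, of K] by auto
    then show "(\<integral>\<^sup>+y\<in>Q. ennreal (w y) \<partial>lebesgue) \<le> ennreal ?m * emeasure lebesgue Q"
      using Q gap_disjoint_child[OF L _ x] by (intro average) blast+
  qed
  have [measurable]: "dyadic_maximal w \<in> borel_measurable lebesgue" "?F i \<in> borel_measurable lebesgue" for i
    by (intro dyadic_maximal_measurable borel_measurable_lebesgue cascade_source_measurable)+
  have [measurable]: "?G \<in> sets lebesgue"
    by simp
  let ?h = "4 ^ K * (1 - child_share K)"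
  have h: "0 \<le> ?h"
    using \<kappa> by simp
  have "(\<integral>\<^sup>+x. ennreal (cascade_source K (Suc n) a L x) * dyadic_maximal w x \<partial>lebesgue) =
      (\<integral>\<^sup>+x. (\<Sum>i<K. ennreal (?F i x) * dyadic_maximal w x) +
        ennreal ?h * (indicator ?G x * dyadic_maximal w x) \<partial>lebesgue)"
  proof (intro nn_integral_cong)
    fix x
    have "ennreal (cascade_source K (Suc n) a L x) =
        (\<Sum>i<K. ennreal (?F i x)) + ennreal ?h * indicator ?G x"
      unfolding cascade_source.simps using h cascade_source_nonneg
      by (subst ennreal_plus) (auto intro: sum_nonneg simp: sum_ennreal ennreal_mult ennreal_indicator)
    then show "ennreal (cascade_source K (Suc n) a L x) * dyadic_maximal w x =
        (\<Sum>i<K. ennreal (?F i x) * dyadic_maximal w x) + ennreal ?h * (indicator ?G x * dyadic_maximal w x)"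
      by (simp only: distrib_right sum_distrib_right mult.assoc)
  qed
  also have "\<dots> = (\<integral>\<^sup>+x. (\<Sum>i<K. ennreal (?F i x) * dyadic_maximal w x) \<partial>lebesgue) +
      (\<integral>\<^sup>+x. ennreal ?h * (indicator ?G x * dyadic_maximal w x) \<partial>lebesgue)"
    by (rule nn_integral_add) measurable
  also have "(\<integral>\<^sup>+x. (\<Sum>i<K. ennreal (?F i x) * dyadic_maximal w x) \<partial>lebesgue) =
      (\<Sum>i<K. \<integral>\<^sup>+x. ennreal (?F i x) * dyadic_maximal w x \<partial>lebesgue)"
    by (rule nn_integral_sum) measurable
  also have "(\<integral>\<^sup>+x. ennreal ?h * (indicator ?G x * dyadic_maximal w x) \<partial>lebesgue) =
      ennreal ?h * (\<integral>\<^sup>+x. indicator ?G x * dyadic_maximal w x \<partial>lebesgue)"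
    by (rule nn_integral_cmult) measurable
  also have "(\<Sum>i<K. \<integral>\<^sup>+x. ennreal (?F i x) * dyadic_maximal w x \<partial>lebesgue) +
      ennreal ?h * (\<integral>\<^sup>+x. indicator ?G x * dyadic_maximal w x \<partial>lebesgue) \<le>
      (\<Sum>i<K. ennreal (real (n + 1) * ?m * half_len i L)) +
      ennreal ?h * (\<integral>\<^sup>+x. ennreal ?m * indicator ?G x \<partial>lebesgue)"
    using gap by (intro add_mono sum_mono mult_left_mono nn_integral_mono child) (auto simp: indicator_def)
  also have "\<dots> = ennreal ((\<Sum>i<K. real (n + 1) * ?m * half_len i L) + ?h * (?m * (2 * half_len K L)))"
  proof -
    have "(\<integral>\<^sup>+x. ennreal ?m * indicator ?G x \<partial>lebesgue) = ennreal ?m * emeasure lebesgue ?G"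
      by (rule nn_integral_cmult_indicator) simp
    moreover have "emeasure lebesgue ?G = ennreal (2 * half_len K L)"
      using half_len_pos[OF L, of K] by simp
    ultimately have "(\<integral>\<^sup>+x. ennreal ?m * indicator ?G x \<partial>lebesgue) = ennreal (?m * (2 * half_len K L))"
      using m'(1) half_len_pos[OF L, of K] by (simp only: ennreal_mult')
    moreover have "(\<Sum>i<K. ennreal (real (n + 1) * ?m * half_len i L)) =
        ennreal (\<Sum>i<K. real (n + 1) * ?m * half_len i L)"
      using m' half_len_pos[OF L] by (intro sum_ennreal mult_nonneg_nonneg) (auto simp: less_imp_le)
    ultimately show ?thesis
      using h m' half_len_pos[OF L]
      by (simp only: ennreal_mult[symmetric] mult_nonneg_nonneg less_imp_le ennreal_plus[symmetric]
          sum_nonneg of_nat_0_le_iff zero_le_numeral)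
  qed
  also have "(\<Sum>i<K. real (n + 1) * ?m * half_len i L) = real (n + 1) * m * L"
  proof -
    have "(\<Sum>i<K. half_len i L) = L * child_share K"
      by (simp add: child_share_eq sum_half_len)
    then show ?thesis
      using \<kappa> by (simp only: sum_distrib_left[symmetric]) simp
  qed
  also have "?h * (?m * (2 * half_len K L)) = L * (1 - child_share K) * ?m"
    unfolding gap_mass[of K L, symmetric] by (simp only: mult_ac)
  also have "L * (1 - child_share K) * ?m \<le> m * L"
  proof -
    have "m * L * ((1 - child_share K) / child_share K) \<le> m * L * 1"
      using \<kappa> m L by (intro mult_left_mono) (auto simp: field_simps)
    then show ?thesis
      by (simp add: mult_ac)
  qed
  also have "real (n + 1) * m * L + m * L = real (Suc n + 1) * m * L"
    by (simp add: algebra_simps)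
  finally show ?case
    by (simp add: add_left_mono ennreal_leI del: cascade_source.simps)
qed

section \<open>Haar multipliers with finitely many non-zero terms\<close>

lemma L2_bounded_support:
  assumes "f \<in> borel_measurable lebesgue" "\<And>x. \<bar>f x\<bar> \<le> B" "\<And>x. x \<notin> {a..<b} \<Longrightarrow> f x = 0"
  shows "f \<in> L2"
proof -
  have "emeasure lebesgue {a..<b} < \<infinity>"
    by (cases "a \<le> b") simp_all
  then have "integrable lebesgue (\<lambda>x. B\<^sup>2 * indicator {a..<b} x :: real)"
    by (intro integrable_mult_right integrable_real_indicator) simp_all
  then have "integrable lebesgue (\<lambda>x. (f x)\<^sup>2)"
  proof (rule Bochner_Integration.integrable_bound)
    show "(\<lambda>x. (f x)\<^sup>2) \<in> borel_measurable lebesgue"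
      using assms(1) by measurable
    show "AE x in lebesgue. norm ((f x)\<^sup>2) \<le> norm (B\<^sup>2 * indicator {a..<b} x)"
    proof (intro AE_I2)
      fix x
      have "\<bar>f x\<bar>\<^sup>2 \<le> B\<^sup>2"
        using assms(2)[of x] by (intro power_mono) auto
      then show "norm ((f x)\<^sup>2) \<le> norm (B\<^sup>2 * indicator {a..<b} x)"
        using assms(3)[of x] by (cases "x \<in> {a..<b}") auto
    qed
  qed
  then show ?thesis
    using assms(1) by (simp add: L2_def)
qed

lemma cascade_source_bounded: "\<exists>B. \<forall>a L x. cascade_source K n a L x \<le> B"
proof (induction n)
  case 0
  have "cascade_source K 0 a L x \<le> 1" for a L x
    by (simp add: indicator_def)
  then show ?case by blast
next
  case (Suc n)
  then obtain B where B: "\<And>a L x. cascade_source K n a L x \<le> B"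
    by blast
  have "cascade_source K (Suc n) a L x \<le> real K * B + 4 ^ K * (1 - child_share K)" for a L x
  proof -
    have "(\<Sum>j<K. cascade_source K n (a + half_len j L) (half_len j L) x) \<le> (\<Sum>j<K. B)"
      by (intro sum_mono B)
    moreover have "4 ^ K * (1 - child_share K) * indicator {a..<a + 2 * half_len K L} x \<le>
        4 ^ K * (1 - child_share K)"
      using child_share_less_1[of K] by (intro mult_left_le) (auto simp: indicator_def)
    ultimately show ?thesis
      by (simp only: cascade_source.simps sum_constant card_lessThan)
  qed
  then show ?case by blast
qed

lemma cascade_source_L2:
  assumes "0 < L"
  shows "cascade_source K n a L \<in> L2"
proof -
  obtain B where "\<And>x. cascade_source K n a L x \<le> B"
    using cascade_source_bounded by blast
  then show ?thesis
    using cascade_source_nonneg cascade_source_eq_0[OF assms]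
    by (intro L2_bounded_support[of _ B a "a + L"] borel_measurable_lebesgue cascade_source_measurable) auto
qed

lemma neg_haar_sum_measurable: "neg_haar_sum A f \<in> borel_measurable borel"
proof -
  have "haar I \<in> borel_measurable borel" for I
    unfolding haar_def[abs_def] left_half_def right_half_def by measurable
  then show ?thesis
    unfolding neg_haar_sum_def[abs_def] by measurable
qed

lemma haar_bound: "\<bar>haar I x\<bar> \<le> 1 / sqrt (measure lebesgue I)"
  by (auto simp: haar_def indicator_def)

lemma neg_haar_sum_spine_L2:
  assumes "0 < L"
  shows "neg_haar_sum (spine K n a L) f \<in> L2"
proof (rule L2_bounded_support)
  let ?A = "spine K n a L"
  show "neg_haar_sum ?A f \<in> borel_measurable lebesgue"
    by (intro borel_measurable_lebesgue neg_haar_sum_measurable)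
  show "\<bar>neg_haar_sum ?A f x\<bar> \<le> (\<Sum>I\<in>?A. \<bar>haar_coeff f I\<bar> * (1 / sqrt (measure lebesgue I)))" for x
  proof -
    have "\<bar>neg_haar_sum ?A f x\<bar> \<le> (\<Sum>I\<in>?A. \<bar>haar_coeff f I * haar I x\<bar>)"
      unfolding neg_haar_sum_def abs_minus_cancel by (rule sum_abs)
    also have "\<dots> \<le> (\<Sum>I\<in>?A. \<bar>haar_coeff f I\<bar> * (1 / sqrt (measure lebesgue I)))"
      unfolding abs_mult by (intro sum_mono mult_left_mono haar_bound) simp
    finally show ?thesis .
  qed
  show "neg_haar_sum ?A f x = 0" if "x \<notin> {a..<a + L}" for x
  proof -
    have "haar I x = 0" if I: "I \<in> ?A" for I
    proof -
      obtain c d where cd: "I = {c..<d}" "c < d" "a \<le> c" "d \<le> a + L"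
        using spine_member[OF assms I] by blast
      then have "x \<notin> {c..<d}"
        using \<open>x \<notin> {a..<a + L}\<close> by auto
      then show ?thesis
        using haar_eq_0[OF cd(2)] cd(1) by simp
    qed
    then show ?thesis
      by (simp add: neg_haar_sum_def)
  qed
qed

text \<open>
  If only finitely many terms of the series are non-zero, the partial sums are eventually constant,
  and a limit in \<open>L\<^sup>2\<close> is determined up to a null set.
\<close>

lemma haar_multiplier_AE_eq_neg_haar_sum:
  assumes "finite A" "A \<subseteq> dyadic_grid" "\<And>I. I \<in> A \<Longrightarrow> \<epsilon> I = - 1"
    and "\<And>I. I \<in> dyadic_grid - A \<Longrightarrow> \<epsilon> I * haar_coeff f I = 0"
    and "neg_haar_sum A f \<in> L2"
  shows "AE x in lebesgue. haar_multiplier \<epsilon> f x = neg_haar_sum A f x"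
proof -
  let ?F = "finite_subsets_at_top dyadic_grid"
  let ?h = "neg_haar_sum A f"
  let ?S = "\<lambda>F x. \<Sum>I\<in>F. \<epsilon> I * haar_coeff f I * haar I x"
  have S: "?S F x = ?h x" if "finite F" "A \<subseteq> F" "F \<subseteq> dyadic_grid" for F x
  proof -
    have "?S F x = ?S A x"
      using that assms(4) by (intro sum.mono_neutral_right) auto
    also have "\<dots> = (\<Sum>I\<in>A. - (haar_coeff f I * haar I x))"
      using assms(3) by (intro sum.cong) auto
    finally show ?thesis
      by (simp add: neg_haar_sum_def sum_negf)
  qed
  have ev: "\<forall>\<^sub>F F in ?F. (\<integral>\<^sup>+x. ennreal ((g x - ?S F x)\<^sup>2) \<partial>lebesgue) =
      (\<integral>\<^sup>+x. ennreal ((g x - ?h x)\<^sup>2) \<partial>lebesgue)" for g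
    unfolding eventually_finite_subsets_at_top
    using assms(1,2) S by (intro exI[of _ A]) simp
  have "haar_multiplier_has_sum \<epsilon> f ?h"
    unfolding haar_multiplier_has_sum_def
    using assms(5) tendsto_eventually[OF ev[of ?h]] by simp
  then have g: "haar_multiplier_has_sum \<epsilon> f (haar_multiplier \<epsilon> f)"
    unfolding haar_multiplier_def by (rule someI[of "haar_multiplier_has_sum \<epsilon> f"])
  let ?g = "haar_multiplier \<epsilon> f"
  have "((\<lambda>F. \<integral>\<^sup>+x. ennreal ((?g x - ?S F x)\<^sup>2) \<partial>lebesgue) \<longlongrightarrow> 0) ?F"
    using g by (simp add: haar_multiplier_has_sum_def)
  then have "(\<integral>\<^sup>+x. ennreal ((?g x - ?h x)\<^sup>2) \<partial>lebesgue) = 0"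
    using tendsto_eventually[OF ev[of ?g]] tendsto_unique finite_subsets_at_top_neq_bot by blast
  moreover have "?g \<in> borel_measurable lebesgue" "?h \<in> borel_measurable lebesgue"
    using g assms(5) by (simp_all add: haar_multiplier_has_sum_def L2_def)
  ultimately have "AE x in lebesgue. ennreal ((?g x - ?h x)\<^sup>2) = 0"
    by (subst (asm) nn_integral_0_iff_AE) simp_all
  then show ?thesis
    by (rule eventually_mono) (simp add: ennreal_eq_0_iff)
qed

section \<open>Large values of the Haar sum\<close>

lemma exp_minus_le:
  fixes y :: real
  assumes "0 \<le> y" "y \<le> 1"
  shows "exp (- y) \<le> 1 - y / 2"
proof -
  have "exp (- y) \<le> 1 / (1 + y)"
    using exp_ge_add_one_self[of y] assms by (simp add: exp_minus field_simps)
  also have "\<dots> \<le> 1 - y / 2"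
  proof -
    have "y * y \<le> y * 1"
      using assms by (intro mult_left_mono) auto
    then show ?thesis
      using assms by (simp add: field_simps)
  qed
  finally show ?thesis .
qed

text \<open>
  The \<open>j\<close>-th payoff is of order \<open>4\<^sup>j\<close> and occurs with probability of order \<open>1 / 4\<^sup>j\<close>, so every
  \<open>j \<ge> 1\<close> adds at least a constant to the mean, which grows linearly in \<open>K\<close>. With \<open>\<theta> = 1 / 4\<^sup>K\<close>
  the exponent stays in \<open>[0, 1]\<close>, where \<open>exp (- y) \<le> 1 - y / 2\<close> turns a large mean into a small moment.
\<close>

lemma stage_moment_bound:
  assumes "2 \<le> K"
  shows "stage_moment K (1 / 4 ^ K) \<le> exp (- (real (K - 1) / (16 * 4 ^ K)))"
proof -
  let ?\<theta> = "1 / 4 ^ K :: real"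
  let ?p = "\<lambda>j. half_len j 1"
  have \<kappa>: "1 / 2 \<le> child_share K" "child_share K \<le> 2 / 3"
    using assms child_share_ge_half[of K] by (auto simp: child_share_eq)
  have payoff_nonneg: "0 \<le> payoff j" for j
    by (simp add: payoff_eq)
  have pay: "exp (- ?\<theta> * payoff j) \<le> 1 - ?\<theta> * payoff j / 2" if "j < K" for j
  proof -
    have "real j \<le> 4 ^ j"
      using of_nat_less_two_power[of j] power_mono[of 2 4 j] by (smt (verit) zero_le_numeral)
    moreover have "2 * (y - 1) / 9 + real j / 3 \<le> y" if "real j \<le> y" for y
      using that by (simp add: field_simps)
    ultimately have "payoff j \<le> 4 ^ j"
      unfolding payoff_eq by blast
    also have "\<dots> \<le> 4 ^ K"
      using that by (intro power_increasing) auto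
    finally show ?thesis
      using exp_minus_le[of "?\<theta> * payoff j"] payoff_nonneg[of j] by simp
  qed
  have mean: "1 / 12 \<le> ?p j * payoff j" if "1 \<le> j" for j
  proof -
    have "(4 :: real) ^ 1 \<le> 4 ^ j"
      using that by (intro power_increasing) auto
    then have "1 / 12 \<le> 1 / 9 * (1 - 1 / (4 :: real) ^ j)"
      by (simp add: field_simps)
    also have "\<dots> = ?p j * (2 * (4 ^ j - 1) / 9)"
      by (simp add: half_len_def field_simps)
    also have "\<dots> \<le> ?p j * payoff j"
      using half_len_pos[of 1 j] by (intro mult_left_mono) (simp_all add: payoff_eq)
    finally show ?thesis .
  qed
  have "real (K - 1) / 12 = (\<Sum>j\<in>{1..<K}. 1 / 12)"
    by simp
  also have "\<dots> \<le> (\<Sum>j\<in>{1..<K}. ?p j * payoff j)"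
    using mean by (intro sum_mono) auto
  also have "\<dots> \<le> (\<Sum>j<K. ?p j * payoff j)"
    using payoff_nonneg half_len_pos[of 1] by (intro sum_mono2) (auto simp: less_imp_le)
  finally have total: "real (K - 1) / 12 \<le> (\<Sum>j<K. ?p j * payoff j)" .
  have "(\<Sum>j<K. ?p j * exp (- ?\<theta> * payoff j)) \<le> (\<Sum>j<K. ?p j * (1 - ?\<theta> * payoff j / 2))"
    using pay half_len_pos[of 1] by (intro sum_mono mult_left_mono) (auto simp: less_imp_le)
  also have "\<dots> = child_share K - ?\<theta> / 2 * (\<Sum>j<K. ?p j * payoff j)"
    by (simp add: child_share_def right_diff_distrib sum_subtractf sum_distrib_left sum_divide_distrib mult_ac)
  also have "\<dots> \<le> child_share K - ?\<theta> / 2 * (real (K - 1) / 12)"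
    using total by (intro diff_left_mono mult_left_mono) auto
  also have "\<dots> \<le> child_share K - child_share K * (real (K - 1) / (16 * 4 ^ K))"
  proof -
    have "child_share K * (real (K - 1) / (16 * 4 ^ K)) \<le> 2 / 3 * (real (K - 1) / (16 * 4 ^ K))"
      using \<kappa> by (intro mult_right_mono) auto
    then show ?thesis
      by (simp add: mult_ac)
  qed
  finally have "stage_moment K ?\<theta> \<le>
      (child_share K - child_share K * (real (K - 1) / (16 * 4 ^ K))) / child_share K"
    unfolding stage_moment_def using \<kappa> by (intro divide_right_mono) auto
  also have "\<dots> = 1 + - (real (K - 1) / (16 * 4 ^ K))"
    using \<kappa> by (simp add: diff_divide_distrib)
  also have "\<dots> \<le> exp (- (real (K - 1) / (16 * 4 ^ K)))"
    by (rule exp_ge_add_one_self)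
  finally show ?thesis .
qed

lemma ennreal_integral_le_nn_integral:
  assumes "integrable M f"
  shows "ennreal (\<integral>x. f x \<partial>M) \<le> (\<integral>\<^sup>+x. ennreal (f x) \<partial>M)"
proof -
  have max: "integrable M (\<lambda>x. max 0 (f x))"
    using assms by simp
  have "ennreal (\<integral>x. f x \<partial>M) \<le> ennreal (\<integral>x. max 0 (f x) \<partial>M)"
    using assms max by (intro ennreal_leI integral_mono) auto
  also have "\<dots> = (\<integral>\<^sup>+x. ennreal (max 0 (f x)) \<partial>M)"
    using max by (subst nn_integral_eq_integral) auto
  also have "\<dots> = (\<integral>\<^sup>+x. ennreal (f x) \<partial>M)"
    by (intro nn_integral_cong) (simp add: max_def ennreal_neg)
  finally show ?thesis .
qed

text \<open>
  A Chernoff bound. The moment of all stages is at most \<open>exp (- 2 * (K - 1))\<close>, while at the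
  level in question \<open>\<theta>\<close> times the level is only \<open>K - 1\<close>; the sum is below the level with probability at
  most \<open>exp (- (K - 1)) \<le> 1 / 2\<close>. The number of stages has to be of order \<open>4\<^sup>K\<close>, the size of the
  largest payoff.
\<close>

lemma cascade_large_deviation:
  assumes "2 \<le> K"
  defines "n \<equiv> 32 * 4 ^ K"
  shows "ennreal (1 / 2) \<le> (\<integral>\<^sup>+x. ennreal (cascade_weight K n a 1 x) *
    indicator {x. real n * real (K - 1) / 32 < neg_haar_sum (spine K n a 1) (cascade_source K n a 1) x} x
    \<partial>lebesgue)"
proof -
  let ?S = "neg_haar_sum (spine K n a 1) (cascade_source K n a 1)"
  let ?W = "cascade_weight K n a 1"
  let ?t = "real n * real (K - 1) / 32"
  let ?\<theta> = "1 / 4 ^ K :: real"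
  have \<theta>t: "?\<theta> * ?t = real (K - 1)"
    by (simp add: n_def)
  let ?D = "\<lambda>x. ?W x - exp (real (K - 1)) * (exp (- ?\<theta> * ?S x) * ?W x)"
  \<comment> \<open>Where the Haar sum is at most \<open>?t\<close>, the term subtracted in \<open>?D\<close> is at least the weight, so that
    \<open>?D\<close> lies below the weight restricted to the set in question.\<close>
  have D: "has_bochner_integral lebesgue ?D (1 - exp (real (K - 1)) * (1 * stage_moment K ?\<theta> ^ n))"
    using assms(1) by (intro has_bochner_integral_diff has_bochner_integral_mult_right
        cascade_weight_integral exponential_moment) auto
  have "stage_moment K ?\<theta> ^ n \<le> exp (- (real (K - 1) / (16 * 4 ^ K))) ^ n"
  proof (rule power_mono[OF stage_moment_bound[OF assms(1)]])
    show "0 \<le> stage_moment K ?\<theta>"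
      using half_len_pos[of 1] child_share_ge_half[of K] assms(1)
      by (auto simp: stage_moment_def less_imp_le intro!: divide_nonneg_nonneg sum_nonneg)
  qed
  also have "\<dots> = exp (- (2 * real (K - 1)))"
    by (simp add: exp_of_nat_mult[symmetric] n_def)
  finally have "exp (real (K - 1)) * stage_moment K ?\<theta> ^ n \<le> exp (real (K - 1)) * exp (- (2 * real (K - 1)))"
    by (intro mult_left_mono) auto
  also have "\<dots> = exp (- real (K - 1))"
    by (simp add: exp_add[symmetric])
  also have "\<dots> \<le> exp (- 1)"
    using assms(1) by simp
  also have "\<dots> \<le> 1 / 2"
    using exp_minus_le[of 1] by simp
  finally have "ennreal (1 / 2) \<le> ennreal (1 - exp (real (K - 1)) * (1 * stage_moment K ?\<theta> ^ n))"
    by (intro ennreal_leI) simp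
  also have "\<dots> = ennreal (\<integral>x. ?D x \<partial>lebesgue)"
    using D by (simp only: has_bochner_integral_integral_eq)
  also have "\<dots> \<le> (\<integral>\<^sup>+x. ennreal (?D x) \<partial>lebesgue)"
    using D by (intro ennreal_integral_le_nn_integral) (auto simp: has_bochner_integral_iff)
  also have "\<dots> \<le> (\<integral>\<^sup>+x. ennreal (?W x) * indicator {x. ?t < ?S x} x \<partial>lebesgue)"
  proof (intro nn_integral_mono)
    fix x
    have W: "0 \<le> ?W x"
      by (rule cascade_weight_nonneg)
    show "ennreal (?D x) \<le> ennreal (?W x) * indicator {x. ?t < ?S x} x"
    proof (cases "?t < ?S x")
      case True
      then show ?thesis
        using W by (auto intro: ennreal_leI)
    next
      case False
      then have "?\<theta> * ?S x \<le> ?\<theta> * ?t"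
        by (intro mult_left_mono) auto
      then have "1 \<le> exp (real (K - 1) + - ?\<theta> * ?S x)"
        unfolding \<theta>t by simp
      then have "1 * ?W x \<le> exp (real (K - 1) + - ?\<theta> * ?S x) * ?W x"
        using W by (intro mult_right_mono)
      then have "?D x \<le> 0"
        by (simp only: exp_add mult_1 mult.assoc diff_le_0_iff_le)
      then show ?thesis
        by (simp add: ennreal_neg)
    qed
  qed
  finally show ?thesis .
qed

section \<open>Gluing the blocks\<close>

lemma unit_interval_dyadic: "{real k..<real k + 1} \<in> dyadic_grid"
proof -
  have "{real k..<real k + 1} = {2 powi 0 * real_of_int (int k) ..< 2 powi 0 * (real_of_int (int k) + 1)}"
    by simp
  then show ?thesis
    unfolding dyadic_grid_def by blast
qed

text \<open>
  One weight and one multiplier have to defeat every constant, so cascades with growing parameters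
  are placed on the intervals \<open>[k, k + 1)\<close>.
\<close>

definition block_stages :: "nat \<Rightarrow> nat" where
  "block_stages k = 32 * 4 ^ (k + 2)"

definition block_weight :: "nat \<Rightarrow> real \<Rightarrow> real" where
  "block_weight k = cascade_weight (k + 2) (block_stages k) (real k) 1"

definition block_source :: "nat \<Rightarrow> real \<Rightarrow> real" where
  "block_source k = cascade_source (k + 2) (block_stages k) (real k) 1"

definition block_spine :: "nat \<Rightarrow> real set set" where
  "block_spine k = spine (k + 2) (block_stages k) (real k) 1"

definition glued_weight :: "real \<Rightarrow> real" where
  "glued_weight x = block_weight (nat \<lfloor>x\<rfloor>) x"

definition glued_multiplier :: "real set \<Rightarrow> real" where
  "glued_multiplier I = (if \<exists>k. I \<in> block_spine k then - 1 else 0)"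

lemma glued_weight_on_block:
  assumes "x \<in> {real k..<real k + 1}"
  shows "glued_weight x = block_weight k x"
proof -
  have "\<lfloor>x\<rfloor> = int k"
    using assms by (intro floor_unique) auto
  then show ?thesis
    by (simp add: glued_weight_def)
qed

lemma glued_weight_nonneg: "0 \<le> glued_weight x"
  by (simp add: glued_weight_def block_weight_def cascade_weight_nonneg)

lemma block_weight_le_glued_weight: "block_weight k x \<le> glued_weight x"
proof (cases "x \<in> {real k..<real k + 1}")
  case True
  then show ?thesis
    by (simp add: glued_weight_on_block)
next
  case False
  then have "block_weight k x = 0"
    unfolding block_weight_def by (intro cascade_weight_eq_0) simp_all
  then show ?thesis
    by (simp add: glued_weight_nonneg)
qed

lemma glued_weight_measurable: "glued_weight \<in> borel_measurable lebesgue"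
proof (rule borel_measurable_lebesgue)
  have "(\<lambda>x. block_weight (nat \<lfloor>x\<rfloor>) x) \<in> borel_measurable borel"
    by (rule measurable_compose_countable) (simp_all add: block_weight_def)
  then show "glued_weight \<in> borel_measurable borel"
    by (simp add: glued_weight_def[abs_def])
qed

lemma glued_weight_unit_interval:
  "(\<integral>\<^sup>+x\<in>{real_of_int i..<real_of_int i + 1}. ennreal (glued_weight x) \<partial>lebesgue) \<le> 1"
proof (cases "0 \<le> i")
  case True
  then obtain k where i: "i = int k"
    using nonneg_int_cases by blast
  have "(\<integral>\<^sup>+x\<in>{real_of_int i..<real_of_int i + 1}. ennreal (glued_weight x) \<partial>lebesgue) \<le>
      (\<integral>\<^sup>+x. ennreal (block_weight k x) \<partial>lebesgue)"
    unfolding i using glued_weight_on_block[of _ k] by (intro nn_integral_mono) (auto simp: indicator_def)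
  also have "\<dots> = 1"
    unfolding block_weight_def by (subst cascade_weight_nn_integral) simp_all
  finally show ?thesis .
next
  case False
  have zero: "ennreal (glued_weight x) * indicator {real_of_int i..<real_of_int i + 1} x = 0" for x
  proof (cases "x \<in> {real_of_int i..<real_of_int i + 1}")
    case True
    then have "x < 0"
      using \<open>\<not> 0 \<le> i\<close> by simp
    then have "glued_weight x = 0"
      unfolding glued_weight_def block_weight_def by (intro cascade_weight_eq_0) auto
    then show ?thesis by simp
  qed simp
  show ?thesis
    by (simp only: zero) simp
qed

lemma glued_weight_integer_interval:
  fixes c d :: int
  assumes "c \<le> d"
  shows "(\<integral>\<^sup>+x\<in>{real_of_int c..<real_of_int d}. ennreal (glued_weight x) \<partial>lebesgue) \<le>
    ennreal (real_of_int (d - c))"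
  using assms
proof (induction d rule: int_ge_induct)
  case base
  then show ?case by simp
next
  case (step d)
  note [measurable] = glued_weight_measurable
  let ?int = "\<lambda>A. \<integral>\<^sup>+x\<in>A. ennreal (glued_weight x) \<partial>lebesgue"
  have "?int {real_of_int c..<real_of_int (d + 1)} =
      (\<integral>\<^sup>+x. ennreal (glued_weight x) * indicator {real_of_int c..<real_of_int d} x +
        ennreal (glued_weight x) * indicator {real_of_int d..<real_of_int d + 1} x \<partial>lebesgue)"
    using step.hyps by (intro nn_integral_cong) (auto simp: indicator_def)
  also have "\<dots> = ?int {real_of_int c..<real_of_int d} + ?int {real_of_int d..<real_of_int d + 1}"
    by (intro nn_integral_add borel_measurable_times_ennreal borel_measurable_indicator) simp_all
  also have "\<dots> \<le> ennreal (real_of_int (d - c)) + ennreal 1"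
    using step.IH glued_weight_unit_interval[of d] by (intro add_mono) simp_all
  also have "\<dots> = ennreal (real_of_int (d + 1 - c))"
    using step.hyps by (subst ennreal_plus[symmetric]) (simp_all add: algebra_simps)
  finally show ?case .
qed

lemma weight_glued_weight: "weight glued_weight"
  unfolding weight_def
proof (intro conjI allI impI)
  show "0 \<le> glued_weight x" for x
    by (rule glued_weight_nonneg)
next
  fix K :: "real set"
  assume K: "compact K"
  then obtain B where B: "\<And>x. x \<in> K \<Longrightarrow> \<bar>x\<bar> \<le> B"
    using compact_imp_bounded bounded_real by metis
  define N where "N = \<lceil>\<bar>B\<bar>\<rceil> + 1"
  have sub: "K \<subseteq> {real_of_int (- N)..<real_of_int N}"
  proof
    fix x assume "x \<in> K"
    then have "\<bar>x\<bar> \<le> \<bar>B\<bar>"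
      using B by fastforce
    moreover have "\<bar>B\<bar> < real_of_int N"
      unfolding N_def by linarith
    ultimately show "x \<in> {real_of_int (- N)..<real_of_int N}"
      by auto
  qed
  have "(\<integral>\<^sup>+x. ennreal (indicator K x * glued_weight x) \<partial>lebesgue) \<le>
      (\<integral>\<^sup>+x\<in>{real_of_int (- N)..<real_of_int N}. ennreal (glued_weight x) \<partial>lebesgue)"
    using sub by (intro nn_integral_mono) (auto simp: indicator_def)
  also have "\<dots> \<le> ennreal (real_of_int (N - (- N)))"
    by (rule glued_weight_integer_interval) (simp add: N_def)
  also have "\<dots> < \<infinity>"
    by simp
  finally have fin: "(\<integral>\<^sup>+x. ennreal (indicator K x * glued_weight x) \<partial>lebesgue) < \<infinity>" .
  have "K \<in> sets lebesgue"
    using K by (simp add: borel_compact)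
  then show "set_integrable lebesgue K glued_weight"
    unfolding set_integrable_def using fin glued_weight_measurable glued_weight_nonneg
    by (intro integrableI_nonneg) auto
qed

text \<open>
  All blocks have mass one. The blocks therefore do not disturb each other: averages over intervals
  larger than a block are at most the average over the block.
\<close>

lemma glued_weight_average_above_block:
  assumes "Q \<in> dyadic_grid" "{real k..<real k + 1} \<subseteq> Q"
  shows "(\<integral>\<^sup>+x\<in>Q. ennreal (glued_weight x) \<partial>lebesgue) \<le> ennreal 1 * emeasure lebesgue Q"
proof -
  obtain e m where Q: "Q = {2 powi e * real_of_int m ..< 2 powi e * (real_of_int m + 1)}"
    using assms(1) unfolding dyadic_grid_def by blast
  have "2 powi e * real_of_int m \<le> real k" "real k + 1 \<le> 2 powi e * (real_of_int m + 1)"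
    using atLeastLessThan_subset_iff[OF assms(2)[unfolded Q]] by auto
  then have "1 \<le> (2 :: real) powi e"
    by (simp add: distrib_left)
  then have "0 \<le> e"
    using power_int_strict_increasing[of e 0 "2 :: real"] by (cases "0 \<le> e") auto
  then have "2 powi e = real_of_int (2 ^ nat e)"
    by (simp add: power_int_def)
  then have Q': "Q = {real_of_int (2 ^ nat e * m) ..< real_of_int (2 ^ nat e * (m + 1))}"
    unfolding Q by simp
  have "2 ^ nat e * m \<le> 2 ^ nat e * (m + 1)"
    by (intro mult_left_mono) auto
  from glued_weight_integer_interval[OF this] show ?thesis
    unfolding Q' by (simp add: algebra_simps)
qed

lemma block_cost:
  "(\<integral>\<^sup>+x. ennreal \<bar>block_source k x\<bar> * dyadic_maximal glued_weight x \<partial>lebesgue) \<le>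
    ennreal (real (block_stages k + 1))"
proof -
  have "(\<integral>\<^sup>+x. ennreal (cascade_source (k + 2) (block_stages k) (real k) 1 x) *
      dyadic_maximal glued_weight x \<partial>lebesgue) \<le> ennreal (real (block_stages k + 1) * 1 * 1)"
    using glued_weight_on_block glued_weight_average_above_block unit_interval_dyadic
    by (intro cascade_cost) (auto simp: block_weight_def)
  then show ?thesis
    by (simp add: block_source_def cascade_source_nonneg)
qed

text \<open>
  A Haar function inside another block is orthogonal to the source of block \<open>k\<close>, and the multiplier
  vanishes on all intervals that belong to no spine. Only the spine of block \<open>k\<close> remains.
\<close>

lemma glued_multiplier_block:
  "AE x in lebesgue. haar_multiplier glued_multiplier (block_source k) x =
    neg_haar_sum (block_spine k) (block_source k) x"
proof (rule haar_multiplier_AE_eq_neg_haar_sum)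
  show "finite (block_spine k)"
    by (simp add: block_spine_def finite_spine)
  show "block_spine k \<subseteq> dyadic_grid"
    unfolding block_spine_def by (intro spine_dyadic unit_interval_dyadic) simp
  show "glued_multiplier I = - 1" if "I \<in> block_spine k" for I
    using that by (auto simp: glued_multiplier_def)
  show "neg_haar_sum (block_spine k) (block_source k) \<in> L2"
    unfolding block_spine_def by (intro neg_haar_sum_spine_L2) simp
next
  fix I assume I: "I \<in> dyadic_grid - block_spine k"
  show "glued_multiplier I * haar_coeff (block_source k) I = 0"
  proof (cases "\<exists>k'. I \<in> block_spine k'")
    case True
    then obtain k' where k': "I \<in> block_spine k'" "k' \<noteq> k"
      using I by blast
    from spine_member[OF zero_less_one k'(1)[unfolded block_spine_def]]
    obtain c d where cd: "I = {c..<d}" "c < d" "real k' \<le> c" "d \<le> real k' + 1"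
      by blast
    have zero: "block_source k y * haar I y = 0" for y
    proof (cases "y \<in> {c..<d}")
      case True
      then have "y \<notin> {real k..<real k + 1}"
        using cd k'(2) by auto
      then have "block_source k y = 0"
        unfolding block_source_def by (intro cascade_source_eq_0) simp_all
      then show ?thesis by simp
    next
      case False
      then show ?thesis
        using haar_eq_0[OF cd(2)] cd(1) by simp
    qed
    show ?thesis
      by (simp only: haar_coeff_def zero) simp
  next
    case False
    then show ?thesis
      by (simp add: glued_multiplier_def)
  qed
qed

lemma block_gain:
  "ennreal (1 / 2) \<le> weight_measure glued_weight
    {x. \<bar>haar_multiplier glued_multiplier (block_source k) x\<bar> > real (block_stages k) * real (k + 1) / 32}"
proof -
  let ?t = "real (block_stages k) * real (k + 1) / 32"
  let ?S = "neg_haar_sum (block_spine k) (block_source k)"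
  let ?T = "haar_multiplier glued_multiplier (block_source k)"
  have "ennreal (1 / 2) \<le> (\<integral>\<^sup>+x. ennreal (block_weight k x) * indicator {x. ?t < ?S x} x \<partial>lebesgue)"
    using cascade_large_deviation[of "k + 2" "real k"]
    by (simp add: block_weight_def block_source_def block_spine_def block_stages_def)
  also have "\<dots> \<le> (\<integral>\<^sup>+x. ennreal (glued_weight x) * indicator {x. \<bar>?T x\<bar> > ?t} x \<partial>lebesgue)"
  proof (rule nn_integral_mono_AE, rule eventually_mono[OF glued_multiplier_block[of k]])
    fix x assume x: "?T x = ?S x"
    show "ennreal (block_weight k x) * indicator {x. ?t < ?S x} x \<le>
        ennreal (glued_weight x) * indicator {x. \<bar>?T x\<bar> > ?t} x"
      using x block_weight_le_glued_weight[of k x]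
      by (intro mult_mono ennreal_leI) (auto simp: indicator_def)
  qed
  finally show ?thesis
    by (simp add: weight_measure_def)
qed

theorem corollary1p5:
  "\<exists>(w :: real \<Rightarrow> real) (\<epsilon> :: real set \<Rightarrow> real).
     weight w \<and> bounded (\<epsilon> ` dyadic_grid) \<and>
     \<not> (\<exists>C::real. \<forall>f\<in>L2.
          (SUP t\<in>{0<..}. ennreal t * weight_measure w {x. \<bar>haar_multiplier \<epsilon> f x\<bar> > t})
            \<le> ennreal C * (\<integral>\<^sup>+x. ennreal \<bar>f x\<bar> * dyadic_maximal w x \<partial>lebesgue))"
proof (intro exI conjI notI)
  show "weight glued_weight"
    by (rule weight_glued_weight)
  have "glued_multiplier ` dyadic_grid \<subseteq> {- 1, 0}"
    by (auto simp: glued_multiplier_def)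
  then show "bounded (glued_multiplier ` dyadic_grid)"
    by (rule bounded_subset[rotated]) simp
  assume "\<exists>C::real. \<forall>f\<in>L2.
    (SUP t\<in>{0<..}. ennreal t * weight_measure glued_weight {x. \<bar>haar_multiplier glued_multiplier f x\<bar> > t})
      \<le> ennreal C * (\<integral>\<^sup>+x. ennreal \<bar>f x\<bar> * dyadic_maximal glued_weight x \<partial>lebesgue)"
  then obtain C :: real where C: "\<And>f. f \<in> L2 \<Longrightarrow>
    (SUP t\<in>{0<..}. ennreal t * weight_measure glued_weight {x. \<bar>haar_multiplier glued_multiplier f x\<bar> > t})
      \<le> ennreal C * (\<integral>\<^sup>+x. ennreal \<bar>f x\<bar> * dyadic_maximal glued_weight x \<partial>lebesgue)"
    by blast
  define C' where "C' = max 0 C"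
  \<comment> \<open>Block \<open>k\<close> with \<open>n\<close> stages has level times weighted measure at least \<open>n * (k + 1) / 64\<close>,
    and cost at most \<open>n + 1 \<le> 2 * n\<close>.\<close>
  define k where "k = nat \<lceil>128 * C'\<rceil>"
  define n where "n = block_stages k"
  let ?f = "block_source k"
  let ?t = "real n * real (k + 1) / 32"
  have n: "1 \<le> n"
    by (simp add: n_def block_stages_def)
  have "ennreal (?t * (1 / 2)) = ennreal ?t * ennreal (1 / 2)"
    by (rule ennreal_mult) simp_all
  also have "\<dots> \<le> ennreal ?t * weight_measure glued_weight {x. \<bar>haar_multiplier glued_multiplier ?f x\<bar> > ?t}"
    using block_gain[of k] unfolding n_def by (intro mult_left_mono) simp_all
  also have "\<dots> \<le> (SUP t\<in>{0<..}. ennreal t *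
      weight_measure glued_weight {x. \<bar>haar_multiplier glued_multiplier ?f x\<bar> > t})"
    using n by (intro SUP_upper) simp
  also have "\<dots> \<le> ennreal C * (\<integral>\<^sup>+x. ennreal \<bar>?f x\<bar> * dyadic_maximal glued_weight x \<partial>lebesgue)"
    by (intro C) (simp add: block_source_def cascade_source_L2)
  also have "\<dots> \<le> ennreal C' * ennreal (real (n + 1))"
    unfolding n_def C'_def by (intro mult_mono ennreal_leI block_cost) simp_all
  also have "\<dots> = ennreal (C' * real (n + 1))"
    by (rule ennreal_mult[symmetric]) (simp_all add: C'_def)
  finally have "?t * (1 / 2) \<le> C' * real (n + 1)"
    by (subst (asm) ennreal_le_iff) (simp_all add: C'_def)
  also have "\<dots> \<le> C' * (2 * real n)"
    using n by (intro mult_left_mono) (simp_all add: C'_def)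
  finally have "real n * real (k + 1) \<le> real n * (128 * C')"
    by (simp add: mult_ac)
  then have "real (k + 1) \<le> 128 * C'"
    using n by simp
  moreover have "128 * C' \<le> real k"
    unfolding k_def by (rule real_nat_ceiling_ge)
  ultimately show False
    by simp
qed

end
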